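(* Let $\alpha \in (-1,1)$. Let $\varphi$ be a univalent holomorphic self-map of $\mathbb{D}$, and let $\psi \in \mathrm{Hol}(\mathbb{D})$ satisfy (i) $\sup_{z \in \mathbb{D}}|\psi''(z)|(1-|z|^2)<\infty$, (ii) $\sup_{z \in \mathbb{D}}|\varphi'(z)\psi'(z)|(1-|z|^2)<\infty$, (iii) $\sup_{z \in \mathbb{D}}|\varphi''(z)\psi(z)|(1-|z|^2)<\infty$, (iv) $\sup_{z \in \mathbb{D}}|\varphi'(z)\psi(z)|\left(\frac{1-|z|^2}{1-|\varphi(z)|^2}\right)^{\frac{\alpha}{2}+1}<\infty$. Then $C_{\psi,\varphi}$ is bounded on $\mathcal{D}_{\alpha}$.
   Context: $\mathbb{D}=\{z\in\mathbb{C}:|z|<1\}$ and $\mathrm{Hol}(\mathbb{D})$ is the space of complex-valued holomorphic functions on $\mathbb{D}$. A holomorphic self-map of $\mathbb{D}$ is $\varphi\in\mathrm{Hol}(\mathbb{D})$ with $\varphi(\mathbb{D})\subseteq\mathbb{D}$; univalent means injective. For $\psi\in\mathrm{Hol}(\mathbb{D})$ and a holomorphic self-map $\varphi$, the weighted composition operator is $C_{\psi,\varphi}f=\psi\,(f\circ\varphi)$ for $f\in\mathrm{Hol}(\mathbb{D})$. For $\alpha\in\mathbb{R}$, the weighted Dirichlet space $\mathcal{D}_\alpha$ is the Hilbert space of all $f(z)=\sum_{n\ge 0}a_nz^n\in\mathrm{Hol}(\mathbb{D})$ with $\|f\|_{\mathcal{D}_\alpha}^2=\sum_{n\ge 0}(n+1)^{1-\alpha}|a_n|^2<\infty$,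 with inner product $\langle f,g\rangle_{\mathcal{D}_\alpha}=\sum_{n\ge 0}(n+1)^{1-\alpha}a_n\overline{b_n}$ for $g(z)=\sum_{n\ge0} b_nz^n$. "$C_{\psi,\varphi}$ is bounded on $\mathcal{D}_\alpha$" means that it maps $\mathcal{D}_\alpha$ into itself and is a bounded linear operator there. *)

theory Defs
  imports "HOL-Complex_Analysis.Complex_Analysis"
begin

text \<open>
  A function on the unit disc is represented by a function on the whole complex plane whose values
  outside the disc are irrelevant. In particular, if \<open>\<phi>\<close> maps the disc into itself, the values of
  \<open>weighted_composition \<psi> \<phi> f\<close> on the disc depend only on those of \<open>f\<close> there.
\<close>

abbreviation unit_disc :: "complex set" where
  "unit_disc \<equiv> ball 0 1"

definition holomorphic_self_map :: "(complex \<Rightarrow> complex) \<Rightarrow> bool" where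
  "holomorphic_self_map \<phi> \<longleftrightarrow> \<phi> holomorphic_on unit_disc \<and> \<phi> ` unit_disc \<subseteq> unit_disc"

definition weighted_composition ::
    "(complex \<Rightarrow> complex) \<Rightarrow> (complex \<Rightarrow> complex) \<Rightarrow> (complex \<Rightarrow> complex) \<Rightarrow> complex \<Rightarrow> complex" where
  "weighted_composition \<psi> \<phi> f = (\<lambda>z. \<psi> z * f (\<phi> z))"

text \<open>\<open>dirichlet_term \<alpha> f n\<close> is $(n+1)^{1-\alpha}|a_n|^2$, where $a_n$ is the $n$-th Taylor
  coefficient of \<open>f\<close> at 0.\<close>

definition dirichlet_term :: "real \<Rightarrow> (complex \<Rightarrow> complex) \<Rightarrow> nat \<Rightarrow> real" where
  "dirichlet_term \<alpha> f n = real (n + 1) powr (1 - \<alpha>) * (cmod (fps_nth (fps_expansion f 0) n))\<^sup>2"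

definition dirichlet_space :: "real \<Rightarrow> (complex \<Rightarrow> complex) set" where
  "dirichlet_space \<alpha> = {f. f holomorphic_on unit_disc \<and> summable (dirichlet_term \<alpha> f)}"

definition dirichlet_norm :: "real \<Rightarrow> (complex \<Rightarrow> complex) \<Rightarrow> real" where
  "dirichlet_norm \<alpha> f = sqrt (\<Sum>n. dirichlet_term \<alpha> f n)"

text \<open>\<open>T\<close> maps $\mathcal{D}_\alpha$ into itself and is a bounded linear operator there. Linearity is
  required as an identity between functions on the disc.\<close>

definition bounded_on_dirichlet_space ::
    "real \<Rightarrow> ((complex \<Rightarrow> complex) \<Rightarrow> complex \<Rightarrow> complex) \<Rightarrow> bool" where
  "bounded_on_dirichlet_space \<alpha> T \<longleftrightarrow>
     (\<forall>f\<in>dirichlet_space \<alpha>. T f \<in> dirichlet_space \<alpha>) \<and>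
     (\<forall>f\<in>dirichlet_space \<alpha>. \<forall>g\<in>dirichlet_space \<alpha>. \<forall>z\<in>unit_disc.
        T (\<lambda>w. f w + g w) z = T f z + T g z) \<and>
     (\<forall>c. \<forall>f\<in>dirichlet_space \<alpha>. \<forall>z\<in>unit_disc. T (\<lambda>w. c * f w) z = c * T f z) \<and>
     (\<exists>K. \<forall>f\<in>dirichlet_space \<alpha>. dirichlet_norm \<alpha> (T f) \<le> K * dirichlet_norm \<alpha> f)"

end

theory Submission
  imports Defs
begin

text \<open>
  The idea is to trade the coefficient norm for area integrals over the disc, where a univalent
  change of variables is available. For \<open>\<beta> > -1\<close> let \<open>I \<beta> h\<close> be the integral over the disc
  of \<open>|h z|\<^sup>2 (1 - |z|\<^sup>2)\<^sup>\<beta>\<close>. Rotation invariance of area and Parseval's identity on circles give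
  \<open>I \<beta> h = \<pi> (\<Sum>n. |a n|\<^sup>2 B (n + 1, \<beta> + 1))\<close>, where \<open>a\<close> are the Taylor coefficients of \<open>h\<close>, and since
  \<open>B (n + 1, \<beta> + 1)\<close> is of the exact order \<open>(n + 1)\<close> to the power \<open>- \<beta> - 1\<close>, the integral \<open>I \<beta>\<close> is
  equivalent to the squared norm of $\mathcal{D}_{\beta+2}$ (\<open>bergman_integral_equiv_energy\<close>).
  Differentiation maps $\mathcal{D}_\alpha$ to $\mathcal{D}_{\alpha+2}$ and loses only the value at 0, so
  the norm of \<open>g = \<psi> (f \<circ> \<phi>)\<close> in $\mathcal{D}_\alpha$ is controlled by \<open>g 0\<close>, \<open>g' 0\<close> and
  \<open>I (\<alpha> + 2) g''\<close>.

  The hypotheses are tailored to the terms of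
  \<open>g'' = \<psi>'' (f \<circ> \<phi>) + 2 \<phi>' \<psi>' (f' \<circ> \<phi>) + \<phi>'' \<psi> (f' \<circ> \<phi>) + \<phi>' \<psi> (\<phi>' (f'' \<circ> \<phi>))\<close>.
  The first three bounds absorb the factor \<open>(1 - |z|\<^sup>2)\<^sup>2\<close> of the weight and leave multiples of
  \<open>I \<alpha> (f \<circ> \<phi>)\<close> and \<open>I \<alpha> (f' \<circ> \<phi>)\<close>. The last bound replaces the weight at \<open>z\<close> by the weight at
  \<open>\<phi> z\<close>, and the remaining factor \<open>|\<phi>'|\<^sup>2\<close> is the Jacobian of \<open>\<phi>\<close>: since \<open>\<phi>\<close> is injective, that
  term is at most a multiple of \<open>I (\<alpha> + 2) f''\<close> (\<open>univalent_substitution_le_bergman\<close>).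

  What is left is that composition with \<open>\<phi>\<close> is bounded for \<open>I \<alpha>\<close>
  (\<open>energy_dominated_bergman_compose\<close>). Univalence gives this directly, too:
  \<open>I \<alpha> (f \<circ> \<phi>)\<close> is controlled by \<open>f (\<phi> 0)\<close> and \<open>I (\<alpha> + 2) ((f' \<circ> \<phi>) \<phi>')\<close>, the Schwarz-Pick inequality
  bounds \<open>1 - |z|\<^sup>2\<close> by a multiple of \<open>1 - |\<phi> z|\<^sup>2\<close>, and the same change of variables applies.
  Point evaluations are bounded on every $\mathcal{D}_\alpha$, which takes care of the values at 0.
\<close>

section \<open>Area integrals under univalent maps\<close>

text \<open>
  The change of variables theorem for Lebesgue integrals is stated on \<open>real^'n\<close>. These two maps
  carry it over to the complex plane.
\<close>

definition complex_of_vec :: "real^2 \<Rightarrow> complex" where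
  "complex_of_vec v = Complex (v $ 1) (v $ 2)"

definition vec_of_complex :: "complex \<Rightarrow> real^2" where
  "vec_of_complex z = vector [Re z, Im z]"

lemma complex_of_vec_inverse [simp]:
  "vec_of_complex (complex_of_vec v) = v" "complex_of_vec (vec_of_complex z) = z"
  by (simp_all add: complex_of_vec_def vec_of_complex_def vec_eq_iff forall_2)

lemma bounded_linear_complex_of_vec: "bounded_linear complex_of_vec"
  unfolding linear_conv_bounded_linear[symmetric]
  by (rule linearI) (simp_all add: complex_of_vec_def complex_eq_iff)

lemma bounded_linear_vec_of_complex: "bounded_linear vec_of_complex"
  unfolding linear_conv_bounded_linear[symmetric]
  by (rule linearI) (simp_all add: vec_of_complex_def vec_eq_iff forall_2)

lemma complex_of_vec_measurable [measurable]: "complex_of_vec \<in> borel_measurable borel"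
  by (intro borel_measurable_continuous_onI linear_continuous_on bounded_linear_complex_of_vec)

lemma distr_complex_of_vec: "distr lborel borel complex_of_vec = lborel"
proof (rule lborel_eqI[symmetric])
  fix l u :: complex
  assume "\<And>b. b \<in> Basis \<Longrightarrow> l \<bullet> b \<le> u \<bullet> b"
  then have le: "Re l \<le> Re u" "Im l \<le> Im u"
    using \<open>\<And>b. b \<in> Basis \<Longrightarrow> l \<bullet> b \<le> u \<bullet> b\<close>[of 1]
      \<open>\<And>b. b \<in> Basis \<Longrightarrow> l \<bullet> b \<le> u \<bullet> b\<close>[of \<i>]
    by (auto simp: Basis_complex_def)
  have Basis_2: "(Basis :: (real^2) set) = {axis 1 1, axis 2 1}"
    by (auto simp: Basis_vec_def UNIV_2)
  have ne: "axis 1 1 \<noteq> (axis 2 1 :: real^2)"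
    by (simp add: axis_eq_axis)
  have "complex_of_vec -` box l u = box (vec_of_complex l) (vec_of_complex u)"
    by (auto simp: box_def Basis_complex_def Basis_2 inner_axis complex_of_vec_def vec_of_complex_def)
  then show "emeasure (distr lborel borel complex_of_vec) (box l u) = (\<Prod>b\<in>Basis. (u - l) \<bullet> b)"
    using le ne
    by (simp add: emeasure_distr emeasure_lborel_box_eq Basis_complex_def Basis_2 inner_axis
        vec_of_complex_def)
qed simp

text \<open>
  Multiplication by \<open>c\<close> is a rotation followed by a dilation by the factor \<open>|c|\<close>, so \<open>|\<phi>'|\<^sup>2\<close> is the
  real Jacobian of a holomorphic \<open>\<phi>\<close>.
\<close>

lemma det_complex_mult:
  "det (matrix (\<lambda>v. vec_of_complex (c * complex_of_vec v))) = (cmod c)\<^sup>2"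
  by (simp add: det_2 matrix_def vec_of_complex_def complex_of_vec_def axis_def cmod_power2)
     (simp add: power2_eq_square)

lemma has_derivative_vec_of_complex_conjugate:
  assumes "(\<phi> has_field_derivative c) (at (complex_of_vec v))"
  shows "((\<lambda>v. vec_of_complex (\<phi> (complex_of_vec v))) has_derivative
           (\<lambda>v. vec_of_complex (c * complex_of_vec v))) (at v)"
  by (rule bounded_linear.has_derivative[OF bounded_linear_vec_of_complex]
      has_derivative_compose[OF bounded_linear_imp_has_derivative[OF bounded_linear_complex_of_vec]]
      assms[unfolded has_field_derivative_def])+

text \<open>
  This is the change of variables formula for the indicator function of \<open>B\<close>. If the right-hand side
  is infinite there is nothing to prove; otherwise that indicator is integrable on the image, as the
  theorem on \<open>real^2\<close> requires.
\<close>

lemma emeasure_univalent_image: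
  assumes S: "open S" and hol: "\<phi> holomorphic_on S" and inj: "inj_on \<phi> S"
    and B[measurable]: "B \<in> sets borel"
  shows "(\<integral>\<^sup>+z. ennreal ((cmod (deriv \<phi> z))\<^sup>2) * indicator B (\<phi> z) \<partial>restrict_space lborel S)
           \<le> emeasure lborel (B \<inter> \<phi> ` S)"
proof (cases "emeasure lborel (B \<inter> \<phi> ` S) = \<infinity>")
  case False
  have openI: "open (\<phi> ` S)"
    using open_mapping_thm3[OF hol S inj] .
  have [measurable]: "\<phi> ` S \<in> sets borel" "S \<in> sets borel"
    using openI S by auto
  define g where "g = (\<lambda>v. vec_of_complex (\<phi> (complex_of_vec v)))"
  define S' where "S' = complex_of_vec -` S"
  define B' where "B' = complex_of_vec -` B"
  define f :: "real^2 \<Rightarrow> real^1" where "f = (\<lambda>v. indicat_real B' v *\<^sub>R 1)"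
  have S': "S' \<in> sets borel"
    unfolding S'_def using measurable_sets_borel[OF complex_of_vec_measurable] by simp
  have B': "B' \<in> sets borel"
    unfolding B'_def using measurable_sets_borel[OF complex_of_vec_measurable B] by simp
  have image: "g ` S' = complex_of_vec -` (\<phi> ` S)"
  proof (intro equalityI subsetI)
    fix v assume "v \<in> complex_of_vec -` (\<phi> ` S)"
    then obtain z where "z \<in> S" "complex_of_vec v = \<phi> z" by auto
    then have "v = g (vec_of_complex z)" "vec_of_complex z \<in> S'"
      by (auto simp: g_def S'_def) (metis complex_of_vec_inverse(1))
    then show "v \<in> g ` S'" by blast
  qed (auto simp: g_def S'_def)
  have gS': "g ` S' \<in> sets borel"
    unfolding image using measurable_sets_borel[OF complex_of_vec_measurable] by simp
  have em: "emeasure lborel (B' \<inter> g ` S') = emeasure lborel (B \<inter> \<phi> ` S)"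
    unfolding image B'_def
    by (subst distr_complex_of_vec[symmetric], subst emeasure_distr) auto
  have lm: "B' \<inter> g ` S' \<in> lmeasurable"
    using False em B' gS' by (auto simp: fmeasurable_def less_top)
  have eq: "(\<lambda>x. indicat_real (g ` S') x *\<^sub>R f x) = (\<lambda>x. indicat_real (B' \<inter> g ` S') x *\<^sub>R (1::real^1))"
    by (auto simp: f_def indicator_def fun_eq_iff)
  have "f absolutely_integrable_on (g ` S')"
    unfolding set_integrable_def eq using lm
    by (intro integrable_scaleR_left) (auto simp: fmeasurable_def)
  moreover have "integral (g ` S') f = (\<chi> i. measure lborel (B' \<inter> g ` S'))"
  proof -
    have "integral (g ` S') f = (LINT x:g`S'|lebesgue. f x)"
      using calculation set_lebesgue_integral_eq_integral(2) by metis
    also have "\<dots> = (LINT x|lebesgue. indicat_real (B' \<inter> g ` S') x) *\<^sub>R 1"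
      unfolding set_lebesgue_integral_def eq
      using lm by (intro integral_scaleR_left) (auto simp: fmeasurable_def)
    also have "\<dots> = (\<chi> i. measure lborel (B' \<inter> g ` S'))"
      using B' gS' by (simp add: vec_eq_iff)
    finally show ?thesis .
  qed
  moreover have "S' \<in> sets lebesgue" using S' by simp
  moreover have "(g has_derivative (\<lambda>v. vec_of_complex (deriv \<phi> (complex_of_vec x) * complex_of_vec v)))
      (at x within S')" if "x \<in> S'" for x
  proof -
    have "(\<phi> has_field_derivative deriv \<phi> (complex_of_vec x)) (at (complex_of_vec x))"
      by (rule holomorphic_derivI[OF hol S]) (use that in \<open>simp add: S'_def\<close>)
    from has_derivative_at_withinI[OF has_derivative_vec_of_complex_conjugate[OF this]]
    show ?thesis unfolding g_def .
  qed
  moreover have "inj_on g S'"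
  proof (rule inj_onI)
    fix v w assume "v \<in> S'" "w \<in> S'" "g v = g w"
    then have "\<phi> (complex_of_vec v) = \<phi> (complex_of_vec w)"
      unfolding g_def by (metis complex_of_vec_inverse(2))
    then have "complex_of_vec v = complex_of_vec w"
      using inj \<open>v \<in> S'\<close> \<open>w \<in> S'\<close> by (auto simp: S'_def dest: inj_onD)
    then show "v = w" by (metis complex_of_vec_inverse(1))
  qed
  ultimately have
    *: "(\<lambda>x. (cmod (deriv \<phi> (complex_of_vec x)))\<^sup>2 *\<^sub>R f (g x)) absolutely_integrable_on S'"
       "integral S' (\<lambda>x. (cmod (deriv \<phi> (complex_of_vec x)))\<^sup>2 *\<^sub>R f (g x))
          = (\<chi> i. measure lborel (B' \<inter> g ` S'))"
    using has_absolute_integral_change_of_variables[of S' g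
        "\<lambda>x v. vec_of_complex (deriv \<phi> (complex_of_vec x) * complex_of_vec v)" f
        "(\<chi> i. measure lborel (B' \<inter> g ` S'))"]
    by (simp_all add: det_complex_mult)
  define h where "h = (\<lambda>x. (cmod (deriv \<phi> (complex_of_vec x)))\<^sup>2 * indicat_real B (\<phi>
      (complex_of_vec x)))"
  have h: "(cmod (deriv \<phi> (complex_of_vec x)))\<^sup>2 *\<^sub>R f (g x) = h x *\<^sub>R 1" for x
    by (simp add: h_def f_def g_def B'_def indicator_def)
  have h_int: "set_integrable lebesgue S' h"
    using *(1) unfolding set_integrable_def h
    by (auto dest: integrable_bounded_linear[OF bounded_linear_vec_nth[of 1]])
  have "(LINT x:S'|lebesgue. h x) = measure lborel (B' \<inter> g ` S')"
  proof -
    have "(LINT x:S'|lebesgue. h x *\<^sub>R (1::real^1)) = (\<chi> i. measure lborel (B' \<inter> g ` S'))"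
      using * set_lebesgue_integral_eq_integral(2)[OF *(1)] unfolding h by simp
    moreover have "(LINT x:S'|lebesgue. h x *\<^sub>R (1::real^1)) = (LINT x:S'|lebesgue. h x) *\<^sub>R 1"
      using h_int unfolding set_lebesgue_integral_def set_integrable_def scaleR_scaleR[symmetric]
      by (subst integral_scaleR_left[symmetric]) simp_all
    ultimately show ?thesis by (simp add: vec_eq_iff)
  qed
  moreover have "(\<integral>\<^sup>+x. ennreal (indicat_real S' x *\<^sub>R h x) \<partial>lebesgue)
      = ennreal (LINT x:S'|lebesgue. h x)"
    unfolding set_lebesgue_integral_def
    using h_int unfolding set_integrable_def
    by (intro nn_integral_eq_integral) (auto simp: h_def)
  ultimately have *: "(\<integral>\<^sup>+x. ennreal (indicat_real S' x *\<^sub>R h x) \<partial>lebesgue)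
      = emeasure lborel (B \<inter> \<phi> ` S)"
    using False unfolding em[symmetric] by (metis emeasure_eq_ennreal_measure infinity_ennreal_def)
  have [measurable]: "deriv \<phi> \<in> borel_measurable (restrict_space borel S)"
      "\<phi> \<in> borel_measurable (restrict_space borel S)"
    using S hol by (auto intro!: borel_measurable_continuous_on_restrict
        holomorphic_on_imp_continuous_on
        holomorphic_deriv)
  define k where "k = (\<lambda>z. ennreal ((cmod (deriv \<phi> z))\<^sup>2) * indicator B (\<phi> z))"
  have "k \<in> borel_measurable (restrict_space borel S)"
    unfolding k_def by measurable
  then have [measurable]: "(\<lambda>z. k z * indicator S z) \<in> borel_measurable borel"
    using borel_measurable_restrict_space_iff_ennreal[of S borel k] by simp
  have "integral\<^sup>N (restrict_space lborel S) k = (\<integral>\<^sup>+z. k z * indicator S z \<partial>lborel)"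
    by (rule nn_integral_restrict_space) simp
  also have "\<dots> = (\<integral>\<^sup>+v. k (complex_of_vec v) * indicator S (complex_of_vec v) \<partial>lborel)"
    by (subst distr_complex_of_vec[symmetric], subst nn_integral_distr) auto
  also have "\<dots> = (\<integral>\<^sup>+v. k (complex_of_vec v) * indicator S (complex_of_vec v) \<partial>lebesgue)"
    by (rule nn_integral_completion[symmetric])
  also have "(\<lambda>v. k (complex_of_vec v) * indicator S (complex_of_vec v))
      = (\<lambda>x. ennreal (indicat_real S' x *\<^sub>R h x))"
    by (auto simp: fun_eq_iff k_def S'_def h_def indicator_def)
  also note *
  finally show ?thesis by (simp add: k_def)
qed simp

text \<open>
  The previous lemma says that the image under \<open>\<phi>\<close> of the measure with density \<open>|\<phi>'|\<^sup>2\<close> is at most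
  area measure, and the integral of a nonnegative function is monotone in the measure.
\<close>

lemma nn_integral_univalent_image_le:
  assumes S: "open S" and hol: "\<phi> holomorphic_on S" and inj: "inj_on \<phi> S"
    and T: "open T" "\<phi> ` S \<subseteq> T"
    and F[measurable]: "F \<in> borel_measurable (restrict_space borel T)"
  shows "(\<integral>\<^sup>+z. ennreal ((cmod (deriv \<phi> z))\<^sup>2) * F (\<phi> z) \<partial>restrict_space lborel S)
           \<le> integral\<^sup>N (restrict_space lborel T) F"
proof -
  have [measurable]: "deriv \<phi> \<in> borel_measurable (restrict_space borel S)"
      "\<phi> \<in> borel_measurable (restrict_space borel S)"
    using S hol by (auto intro!: borel_measurable_continuous_on_restrict
        holomorphic_on_imp_continuous_on
        holomorphic_deriv)
  have sets_lborel: "sets (restrict_space lborel X)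
      = sets (restrict_space borel X)" for X :: "complex set"
    by (rule sets_restrict_space_cong) simp
  have [measurable]: "\<phi> \<in> restrict_space borel S \<rightarrow>\<^sub>M restrict_space borel T"
    using T by (intro measurable_restrict_space2) (auto simp: space_restrict_space)
  define M where "M = density (restrict_space lborel S) (\<lambda>z. ennreal ((cmod (deriv \<phi> z))\<^sup>2))"
  have M: "measurable M N = measurable (restrict_space borel S) N" for N :: "'b measure"
    unfolding M_def by (rule measurable_cong_sets) (simp_all add: sets_lborel)
  have [measurable]: "\<phi> \<in> M \<rightarrow>\<^sub>M restrict_space borel T"
    unfolding M by measurable
  have le: "distr M (restrict_space borel T) \<phi> \<le> restrict_space lborel T"
  proof (subst le_measure)
    show "\<forall>A\<in>sets (distr M (restrict_space borel T) \<phi>).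
            emeasure (distr M (restrict_space borel T) \<phi>) A \<le> emeasure (restrict_space lborel T) A"
    proof
      fix A assume "A \<in> sets (distr M (restrict_space borel T) \<phi>)"
      then have A: "A \<in> sets (restrict_space borel T)" by simp
      then have A': "A \<in> sets borel" "A \<subseteq> T"
        using T by (auto simp: sets_restrict_space_iff)
      have vimage: "\<phi> -` A \<inter> space M \<in> sets (restrict_space lborel S)"
        using measurable_sets[of \<phi> "restrict_space borel S" "restrict_space borel T" A] A
        by (simp add: M_def sets_lborel space_restrict_space)
      have "emeasure (distr M (restrict_space borel T) \<phi>) A = emeasure M (\<phi> -` A \<inter> space M)"
        using A by (intro emeasure_distr) auto
      also have "\<dots> = (\<integral>\<^sup>+z. ennreal ((cmod (deriv \<phi> z))\<^sup>2) * indicator (\<phi> -` A \<inter> space M) z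
          \<partial>restrict_space lborel S)"
        unfolding M_def using vimage
        by (intro emeasure_density) (auto simp: M_def sets_lborel cong: measurable_cong_sets)
      also have "\<dots> = (\<integral>\<^sup>+z. ennreal ((cmod (deriv \<phi> z))\<^sup>2) * indicator A (\<phi> z) \<partial>restrict_space
          lborel S)"
        by (intro nn_integral_cong) (auto simp: M_def indicator_def)
      also have "\<dots> \<le> emeasure lborel (A \<inter> \<phi> ` S)"
        by (rule emeasure_univalent_image[OF S hol inj A'(1)])
      also have "\<dots> \<le> emeasure lborel A"
        using A' by (intro emeasure_mono) auto
      also have "\<dots> = emeasure (restrict_space lborel T) A"
        using A' T by (intro emeasure_restrict_space[symmetric]) auto
      finally show "emeasure (distr M (restrict_space borel T) \<phi>) A
          \<le> emeasure (restrict_space lborel T) A" .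
    qed
  qed (simp add: sets_lborel)
  have "(\<integral>\<^sup>+z. ennreal ((cmod (deriv \<phi> z))\<^sup>2) * F (\<phi> z) \<partial>restrict_space lborel S) = (\<integral>\<^sup>+z. F (\<phi> z) \<partial>M)"
    unfolding M_def
    by (intro nn_integral_density[symmetric]) (simp_all add: measurable_cong_sets[OF sets_lborel refl])
  also have "\<dots> = integral\<^sup>N (distr M (restrict_space borel T) \<phi>) F"
    by (rule nn_integral_distr[symmetric]) measurable
  also have "\<dots> \<le> integral\<^sup>N (restrict_space lborel T) F"
    by (intro nn_integral_mono_measure le) (simp add: sets_lborel)
  finally show ?thesis .
qed

section \<open>Area integrals of Taylor series\<close>

abbreviation disc_area :: "complex measure" where
  "disc_area \<equiv> restrict_space lborel unit_disc"

lemma sets_disc_area: "sets disc_area = sets (restrict_space borel unit_disc)"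
  by (rule sets_restrict_space_cong) simp

lemma measurable_ident_restrict_borel [measurable]:
  "(\<lambda>x. x) \<in> measurable (restrict_space borel S) borel"
  by (intro measurable_restrict_space1) simp

lemma measurable_disc_areaI [measurable (raw)]:
  "F \<in> measurable (restrict_space borel unit_disc) M \<Longrightarrow> F \<in> measurable disc_area M"
  using measurable_cong_sets[OF sets_disc_area refl] by blast

lemma space_disc_area: "space disc_area = unit_disc"
  by (simp add: space_restrict_space)

lemma holomorphic_borel_measurable_disc:
  "h holomorphic_on unit_disc \<Longrightarrow> h \<in> borel_measurable (restrict_space borel unit_disc)"
  by (intro borel_measurable_continuous_on_restrict holomorphic_on_imp_continuous_on)

text \<open>
  The substitution inequality holds for the rotation by \<open>u\<close> and for its inverse.
\<close>

lemma nn_integral_disc_rotate: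
  assumes u: "cmod u = 1" and F[measurable]: "F \<in> borel_measurable (restrict_space borel unit_disc)"
  shows "(\<integral>\<^sup>+z. F (u * z) \<partial>disc_area) = integral\<^sup>N disc_area F"
proof -
  have le: "(\<integral>\<^sup>+z. G (v * z) \<partial>disc_area) \<le> integral\<^sup>N disc_area G"
    if "cmod v = 1" "G \<in> borel_measurable (restrict_space borel unit_disc)" for v G
  proof -
    have "v \<noteq> 0" using that by auto
    then have "(\<integral>\<^sup>+z. ennreal ((cmod (deriv (\<lambda>z. v * z) z))\<^sup>2) * G (v * z) \<partial>disc_area)
        \<le> integral\<^sup>N disc_area G"
      using that
      by (intro nn_integral_univalent_image_le)
         (auto intro!: holomorphic_intros inj_onI simp: norm_mult)
    moreover have "deriv (\<lambda>z. v * z) z = v" for z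
      by (rule DERIV_imp_deriv) (auto intro!: derivative_eq_intros)
    ultimately show ?thesis using that by simp
  qed
  have [measurable]: "(\<lambda>z. u * z) \<in> restrict_space borel unit_disc \<rightarrow>\<^sub>M restrict_space borel unit_disc"
    using u by (intro measurable_restrict_space2 measurable_restrict_space1)
               (auto simp: space_restrict_space norm_mult)
  have "inverse u * (u * z) = z" "u * (inverse u * z) = z" for z
    using u by (auto simp: field_simps)
  with le[of "inverse u" "\<lambda>z. F (u * z)"] u
  have "integral\<^sup>N disc_area F \<le> (\<integral>\<^sup>+z. F (u * z) \<partial>disc_area)"
    by (simp add: norm_inverse)
  with le[OF u F] show ?thesis by simp
qed

text \<open>
  The area of the disc of radius \<open>\<surd>x\<close> is \<open>\<pi> x\<close>, so \<open>|z|\<^sup>2\<close> is uniformly distributed on the unit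
  disc. The next lemma expresses this as an equality of measures; it stands in for integration in polar
  coordinates.
\<close>

lemma emeasure_disc_area_annulus:
  assumes "0 \<le> x" "x \<le> 1"
  shows "emeasure disc_area {z\<in>unit_disc. x < (cmod z)\<^sup>2} = ennreal (pi * (1 - x))"
proof -
  have "z \<in> unit_disc - cball 0 (sqrt x) \<longleftrightarrow> z \<in> unit_disc \<and> x < (cmod z)\<^sup>2" for z :: complex
    using real_sqrt_less_iff[of x "(cmod z)\<^sup>2"] by (simp add: not_le)
  then have eq: "{z\<in>unit_disc. x < (cmod z)\<^sup>2} = unit_disc - cball 0 (sqrt x)" by blast
  have "emeasure disc_area {z\<in>unit_disc. x < (cmod z)\<^sup>2}
      = emeasure lborel (unit_disc - cball 0 (sqrt x))"
    unfolding eq by (intro emeasure_restrict_space) auto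
  also have "\<dots> = emeasure lborel (unit_disc - ball 0 (sqrt x))"
  proof -
    have "sphere (0::complex) (sqrt x) \<in> null_sets lborel"
      using negligible_sphere[of "0::complex" "sqrt x"]
      by (auto simp: null_sets_completion_iff negligible_iff_null_sets)
    then have "emeasure lborel ((unit_disc - ball 0 (sqrt x)) - sphere (0::complex) (sqrt x))
        = emeasure lborel (unit_disc - ball (0::complex) (sqrt x))"
      by (intro emeasure_Diff_null_set) auto
    moreover have "(unit_disc - ball 0 (sqrt x)) - sphere (0::complex) (sqrt x)
        = unit_disc - cball 0 (sqrt x)"
      by auto
    ultimately show ?thesis by simp
  qed
  also have "\<dots> = emeasure lborel unit_disc - emeasure lborel (ball (0::complex) (sqrt x))"
    using assms by (intro emeasure_Diff) (auto simp: emeasure_ball subset_ball real_sqrt_le_iff)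
  also have "\<dots> = ennreal (pi * (1 - x))"
    using assms by (simp add: emeasure_ball unit_ball_vol_2 ennreal_minus algebra_simps)
  finally show ?thesis .
qed

lemma distr_disc_area_norm_square:
  "distr disc_area borel (\<lambda>z. (cmod z)\<^sup>2) = density lborel (\<lambda>x. ennreal pi * indicator {0..1} x)"
proof (rule measure_eqI_lessThan)
  fix x :: real
  have m[measurable]: "(\<lambda>z. (cmod z)\<^sup>2) \<in> borel_measurable disc_area"
    by measurable
  have L: "emeasure (distr disc_area borel (\<lambda>z. (cmod z)\<^sup>2)) {x<..} =
      emeasure disc_area {z\<in>unit_disc. x < (cmod z)\<^sup>2}"
    by (subst emeasure_distr) (auto simp: space_restrict_space intro!: arg_cong[where f="emeasure
        disc_area"])
  have R: "emeasure (density lborel (\<lambda>x. ennreal pi * indicator {0..1} x)) {x<..} =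
      ennreal pi * emeasure lborel ({x<..} \<inter> {0..1})"
  proof -
    have "emeasure (density lborel (\<lambda>x. ennreal pi * indicator {0..1} x)) {x<..} =
       (\<integral>\<^sup>+y. ennreal pi * indicator ({x<..} \<inter> {0..1}) y \<partial>lborel)"
      by (subst emeasure_density) (auto intro!: nn_integral_cong simp: indicator_def)
    then show ?thesis by (simp add: nn_integral_cmult)
  qed
  have eq: "emeasure disc_area {z\<in>unit_disc. x < (cmod z)\<^sup>2}
      = ennreal pi * emeasure lborel ({x<..} \<inter> {0..1})"
  proof -
    consider "x < 0" | "0 \<le> x" "x \<le> 1" | "x > 1" by linarith
    then show ?thesis
    proof cases
      case 1
      then have "{z\<in>unit_disc. x < (cmod z)\<^sup>2} = unit_disc" "{x<..} \<inter> {0..1} = {0..1}"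
        by (auto intro: less_le_trans)
      then show ?thesis
        by (simp add: emeasure_restrict_space emeasure_ball unit_ball_vol_2)
    next
      case 2
      then have "{x<..} \<inter> {0..1} = {x<..1}" by auto
      then show ?thesis
        using 2 emeasure_disc_area_annulus[OF 2] by (simp add: ennreal_mult'')
    next
      case 3
      have "(cmod z)\<^sup>2 < 1" if "z \<in> unit_disc" for z
        using that power_strict_mono[of "cmod z" 1 2] by simp
      then have "{z\<in>unit_disc. x < (cmod z)\<^sup>2} = {}" "{x<..} \<inter> {0..1} = {}"
        using 3 by (auto, fastforce)
      then show ?thesis by (simp only: emeasure_empty mult_zero_right)
    qed
  qed
  show "emeasure (distr disc_area borel (\<lambda>z. (cmod z)\<^sup>2)) {x<..} =
     emeasure (density lborel (\<lambda>x. ennreal pi * indicator {0..1} x)) {x<..}"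
    unfolding L R eq ..
  have "emeasure lborel ({x<..} \<inter> {0..1}) \<le> emeasure lborel {0..1::real}"
    by (intro emeasure_mono) auto
  then have "emeasure lborel ({x<..} \<inter> {0..1}) < \<infinity>"
    by (rule le_less_trans) simp
  then show "emeasure (distr disc_area borel (\<lambda>z. (cmod z)\<^sup>2)) {x<..} < \<infinity>"
    unfolding L eq by (simp add: ennreal_mult_less_top)
qed simp_all

text \<open>
  Together with the distribution of \<open>|z|\<^sup>2\<close>, Euler's Beta integral gives the moments of the weighted area
  measure.
\<close>

lemma nn_integral_power_Beta:
  assumes "\<beta> > -1"
  shows "(\<integral>\<^sup>+t. ennreal (t ^ n * (1 - t) powr \<beta>) * indicator {0..1} t \<partial>lborel)
      = ennreal (Beta (real n + 1) (\<beta> + 1))"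
proof -
  have "((\<lambda>t. t powr (real n + 1 - 1) * (1 - t) powr (\<beta> + 1 - 1)) has_integral Beta (real n
      + 1) (\<beta> + 1)) {0..1}"
    using assms by (intro has_integral_Beta_real) auto
  then have "((\<lambda>t. t powr real n * (1 - t) powr \<beta>) has_integral Beta (real n + 1) (\<beta> + 1)) {0..1}"
    by simp
  \<comment> \<open>\<open>0 powr 0 = 0\<close> while \<open>0 ^ 0 = 1\<close>, so the two integrands may differ at 0.\<close>
  then have "((\<lambda>t. t ^ n * (1 - t) powr \<beta>) has_integral Beta (real n + 1) (\<beta> + 1)) {0..1}"
    by (rule has_integral_spike[of "{0}", rotated 2]) (auto simp: powr_realpow)
  from has_integral_restrict_UNIV[THEN iffD2, OF this]
  have *: "((\<lambda>t. if t \<in> {0..1} then t ^ n * (1 - t) powr \<beta> else 0) has_integral Beta (real n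
      + 1) (\<beta> + 1)) UNIV" .
  have "(\<integral>\<^sup>+t. ennreal (if t \<in> {0..1} then t ^ n * (1 - t) powr \<beta> else 0) \<partial>lborel)
      = ennreal (Beta (real n + 1) (\<beta> + 1))"
    by (rule nn_integral_has_integral_lborel[OF _ _ *]) auto
  moreover have "ennreal (if t \<in> {0..1} then t ^ n * (1 - t) powr \<beta> else 0)
      = ennreal (t ^ n * (1 - t) powr \<beta>) * indicator {0..1} t" for t
    by (auto simp: indicator_def)
  ultimately show ?thesis by simp
qed

lemma nn_integral_disc_radial_power:
  assumes "\<beta> > -1"
  shows "(\<integral>\<^sup>+z. ennreal ((cmod z) ^ (2 * n) * (1 - (cmod z)\<^sup>2) powr \<beta>) \<partial>disc_area)
           = ennreal (pi * Beta (real n + 1) (\<beta> + 1))"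
proof -
  have "(\<integral>\<^sup>+z. ennreal ((cmod z) ^ (2 * n) * (1 - (cmod z)\<^sup>2) powr \<beta>) \<partial>disc_area)
     = (\<integral>\<^sup>+t. ennreal (t ^ n * (1 - t) powr \<beta>) \<partial>distr disc_area borel (\<lambda>z. (cmod z)\<^sup>2))"
    by (subst nn_integral_distr) (auto simp: power_mult)
  also have "\<dots> = (\<integral>\<^sup>+t. ennreal pi * indicator {0..1} t * ennreal (t ^ n * (1 - t) powr \<beta>) \<partial>lborel)"
    unfolding distr_disc_area_norm_square by (rule nn_integral_density) auto
  also have "\<dots> = (\<integral>\<^sup>+t. ennreal pi * (ennreal (t ^ n * (1 - t) powr \<beta>) * indicator {0..1} t) \<partial>lborel)"
    by (intro nn_integral_cong) (simp add: mult_ac)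
  also have "\<dots> = ennreal pi * ennreal (Beta (real n + 1) (\<beta> + 1))"
    by (subst nn_integral_cmult) (auto simp: nn_integral_power_Beta[OF assms])
  finally show ?thesis by (simp only: ennreal_mult'[OF pi_ge_zero])
qed

abbreviation taylor_coeff :: "(complex \<Rightarrow> complex) \<Rightarrow> nat \<Rightarrow> complex" where
  "taylor_coeff h n \<equiv> fps_nth (fps_expansion h 0) n"

lemma taylor_coeff_sums:
  assumes "h holomorphic_on unit_disc" "z \<in> unit_disc"
  shows "(\<lambda>n. taylor_coeff h n * z ^ n) sums h z"
  using holomorphic_power_series[OF assms] by (simp add: fps_expansion_def)

text \<open>
  The series converges at a point of larger modulus that is still in the disc.
\<close>

lemma summable_norm_taylor:
  assumes "h holomorphic_on unit_disc" "z \<in> unit_disc"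
  shows "summable (\<lambda>n. cmod (taylor_coeff h n * z ^ n))"
proof -
  obtain r where r: "cmod z < r" "r < 1"
    using assms(2) dense[of "cmod z" 1] by auto
  then have "summable (\<lambda>n. taylor_coeff h n * complex_of_real r ^ n)"
    using assms taylor_coeff_sums[of h "of_real r"] norm_ge_zero[of z] by (auto simp: sums_iff)
  then show ?thesis
    by (rule powser_insidea) (use r norm_ge_zero[of z] in auto)
qed

lemma has_integral_cis_period:
  "((\<lambda>t. cis (2 * pi * (real n - real m) * t)) has_integral (if n = m then 1 else 0)) {0..1}"
proof (cases "n = m")
  case True
  then show ?thesis using has_integral_const_real[of "1::complex" 0 1] by simp
next
  case False
  define c where "c = 2 * pi * (real n - real m)"
  have c: "c \<noteq> 0" using False by (simp add: c_def)
  have "((\<lambda>t. cis (c * t)) has_integral (cis (c * 1) / (\<i> * c) - cis (c * 0) / (\<i> * c))) {0..1}"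
  proof (rule fundamental_theorem_of_calculus)
    fix t :: real
    show "((\<lambda>t. cis (c * t) / (\<i> * c)) has_vector_derivative cis (c * t)) (at t within {0..1})"
    proof -
      have "((\<lambda>z. exp (\<i> * complex_of_real c * z) / (\<i> * c)) has_field_derivative
          exp (\<i> * complex_of_real c * complex_of_real t)) (at (complex_of_real t))"
        using c by (auto intro!: derivative_eq_intros)
      from has_vector_derivative_real_field[OF this] show ?thesis
        by (simp add: cis_conv_exp mult.assoc)
    qed
  qed simp
  moreover have "cis c = 1"
    using cis_multiple_2pi[of "real n - real m"] by (simp add: c_def mult_ac)
  ultimately show ?thesis
    using False by (simp add: c_def)
qed

text \<open>
  Expand the square and use that distinct characters of the circle are orthogonal.
\<close>

lemma has_integral_norm_square_trig_polynomial:
  "((\<lambda>t. (cmod (\<Sum>n<N. c n * cis (2 * pi * real n * t)))\<^sup>2) has_integral (\<Sum>n<N. (cmod (c n))\<^sup>2)) {0..1}"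
proof -
  have "((\<lambda>t. \<Sum>n<N. \<Sum>m<N. c n * cnj (c m) * cis (2 * pi * (real n - real m) * t))
      has_integral (\<Sum>n<N. \<Sum>m<N. c n * cnj (c m) * (if n = m then 1 else 0))) {0..1}"
    by (intro has_integral_sum has_integral_mult_right has_integral_cis_period) auto
  also have "(\<Sum>n<N. \<Sum>m<N. c n * cnj (c m) * (if n = m then 1 else 0))
      = complex_of_real (\<Sum>n<N. (cmod (c n))\<^sup>2)"
  proof -
    have "(\<Sum>m<N. c n * cnj (c m) * (if n = m then 1 else 0))
        = complex_of_real ((cmod (c n))\<^sup>2)" if "n < N" for n
    proof -
      have "(\<Sum>m<N. c n * cnj (c m) * (if n = m then 1 else 0))
          = (\<Sum>m<N. if n = m then c n * cnj (c n) else 0)"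
        by (rule sum.cong) auto
      also have "\<dots> = complex_of_real ((cmod (c n))\<^sup>2)"
        using that by (simp only: complex_norm_square sum.delta' finite_lessThan lessThan_iff if_True)
      finally show ?thesis .
    qed
    then show ?thesis by (simp only: of_real_sum) (intro sum.cong, auto)
  qed
  also have "(\<lambda>t. \<Sum>n<N. \<Sum>m<N. c n * cnj (c m) * cis (2 * pi * (real n - real m) * t))
     = (\<lambda>t. complex_of_real ((cmod (\<Sum>n<N. c n * cis (2 * pi * real n * t)))\<^sup>2))"
  proof
    fix t :: real
    have "c n * cnj (c m) * cis (2 * pi * (real n - real m) * t)
        = (c n * cis (2 * pi * real n * t)) * cnj (c m * cis (2 * pi * real m * t))" for n m
    proof -
      have "2 * pi * (real n - real m) * t = 2 * pi * real n * t + - (2 * pi * real m * t)"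
        by (simp add: algebra_simps)
      then have "cis (2 * pi * (real n - real m) * t)
          = cis (2 * pi * real n * t) * cnj (cis (2 * pi * real m * t))"
        by (simp only: cis_cnj cis_mult)
      then show ?thesis by simp
    qed
    then have "(\<Sum>n<N. \<Sum>m<N. c n * cnj (c m) * cis (2 * pi * (real n - real m) * t))
        = (\<Sum>n<N. \<Sum>m<N. (c n * cis (2 * pi * real n * t)) * cnj (c m * cis (2 * pi * real m * t)))"
      by (intro sum.cong refl)
    also have "\<dots> = (\<Sum>n<N. c n * cis (2 * pi * real n * t)) * cnj (\<Sum>n<N. c n * cis (2 * pi * real n
        * t))"
      unfolding cnj_sum by (rule sum_product[symmetric])
    also have "\<dots> = complex_of_real ((cmod (\<Sum>n<N. c n * cis (2 * pi * real n * t)))\<^sup>2)"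
      by (rule complex_norm_square[symmetric])
    finally show "(\<Sum>n<N. \<Sum>m<N. c n * cnj (c m) * cis (2 * pi * (real n - real m) * t))
        = complex_of_real ((cmod (\<Sum>n<N. c n * cis (2 * pi * real n * t)))\<^sup>2)" .
  qed
  finally show ?thesis
    by (auto dest: has_integral_Re simp only: Re_complex_of_real)
qed

text \<open>
  The partial sums of the Taylor series are trigonometric polynomials on the circle through \<open>z\<close>, and
  they are dominated there by the constant \<open>\<Sum>n. |a n z\<^sup>n|\<close>, where \<open>a\<close> are the Taylor coefficients.
\<close>

lemma nn_integral_circle_Parseval:
  assumes h: "h holomorphic_on unit_disc" and z: "z \<in> unit_disc"
  shows "(\<integral>\<^sup>+t. ennreal ((cmod (h (cis (2 * pi * t) * z)))\<^sup>2) * indicator {0..1} t \<partial>lborel)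
           = (\<Sum>n. ennreal ((cmod (taylor_coeff h n))\<^sup>2 * cmod z ^ (2 * n)))"
proof -
  define c where "c n = taylor_coeff h n * z ^ n" for n
  define P where "P N t = (\<Sum>n<N. c n * cis (2 * pi * real n * t))" for N t
  define g where "g t = (cmod (h (cis (2 * pi * t) * z)))\<^sup>2" for t
  have sm: "summable (\<lambda>n. cmod (c n))"
    unfolding c_def by (rule summable_norm_taylor[OF h z])
  have P_int: "((\<lambda>t. (cmod (P N t))\<^sup>2) has_integral (\<Sum>n<N. (cmod (c n))\<^sup>2)) {0..1}" for N
    unfolding P_def by (rule has_integral_norm_square_trig_polynomial)
  have P_lim: "(\<lambda>N. (cmod (P N t))\<^sup>2) \<longlonglongrightarrow> g t" for t
  proof -
    have "cis (2 * pi * t) * z \<in> unit_disc" using z by (simp add: norm_mult)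
    from taylor_coeff_sums[OF h this]
    have "(\<lambda>N. P N t) \<longlonglongrightarrow> h (cis (2 * pi * t) * z)"
      by (simp add: sums_def P_def c_def power_mult_distrib Complex.DeMoivre mult_ac)
    then show ?thesis unfolding g_def by (intro tendsto_intros)
  qed
  have bound: "norm ((cmod (P N t))\<^sup>2) \<le> (\<Sum>n. cmod (c n))\<^sup>2" for N t
  proof -
    have "cmod (P N t) \<le> (\<Sum>n<N. cmod (c n))"
      unfolding P_def by (rule order.trans[OF norm_sum]) (simp add: norm_mult)
    also have "\<dots> \<le> (\<Sum>n. cmod (c n))"
      by (rule sum_le_suminf[OF sm]) auto
    finally show ?thesis by (simp add: power_mono)
  qed
  have g_int: "g integrable_on {0..1}" and g_lim: "(\<lambda>N. integral {0..1} (\<lambda>t. (cmod (P N t))\<^sup>2)) \<longlonglongrightarrow>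
      integral {0..1} g"
    using dominated_convergence[of "\<lambda>N t. (cmod (P N t))\<^sup>2" "{0..1}" "\<lambda>t. (\<Sum>n. cmod (c n))\<^sup>2" g]
      P_int bound P_lim by (auto simp: integrable_const_ivl has_integral_integrable)
  have "(\<lambda>N. \<Sum>n<N. (cmod (c n))\<^sup>2) \<longlonglongrightarrow> integral {0..1} g"
    using g_lim unfolding integral_unique[OF P_int] .
  then have sums: "(\<lambda>n. (cmod (c n))\<^sup>2) sums integral {0..1} g"
    by (simp add: sums_def)
  have cont: "continuous_on UNIV (\<lambda>t. h (cis (2 * pi * t) * z))"
    by (rule continuous_on_compose2[OF holomorphic_on_imp_continuous_on[OF h]])
       (use z in \<open>auto intro!: continuous_intros simp: norm_mult\<close>)
  then have g_meas: "g \<in> borel_measurable borel"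
    unfolding g_def by (intro borel_measurable_continuous_onI continuous_intros)
  have "((\<lambda>t. if t \<in> {0..1} then g t else 0) has_integral integral {0..1} g) UNIV"
    using g_int has_integral_restrict_UNIV integrable_integral by blast
  then have "(\<integral>\<^sup>+t. ennreal (if t \<in> {0..1} then g t else 0) \<partial>lborel) = ennreal (integral {0..1} g)"
    using g_meas by (intro nn_integral_has_integral_lborel) (auto simp: g_def)
  moreover have "(\<lambda>t. ennreal (if t \<in> {0..1} then g t else 0))
      = (\<lambda>t. ennreal (g t) * indicator {0..1} t)"
    by (auto simp: indicator_def)
  moreover have "ennreal (integral {0..1} g) = (\<Sum>n. ennreal ((cmod (c n))\<^sup>2))"
    using sums by (intro suminf_ennreal_eq[symmetric]) auto
  moreover have "(cmod (c n))\<^sup>2 = (cmod (taylor_coeff h n))\<^sup>2 * cmod z ^ (2 * n)" for n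
    by (simp add: c_def norm_mult norm_power power_mult_distrib power_mult[symmetric] mult.commute)
  ultimately show ?thesis by (simp add: g_def)
qed

text \<open>
  The squared norm of the weighted Bergman space with weight \<open>(1 - |z|\<^sup>2)\<^sup>\<beta>\<close>. It takes values in
  \<open>ennreal\<close>, so that infinite norms need no separate treatment.
\<close>

definition bergman_integral :: "real \<Rightarrow> (complex \<Rightarrow> complex) \<Rightarrow> ennreal" where
  "bergman_integral \<beta> h = (\<integral>\<^sup>+z. ennreal ((cmod (h z))\<^sup>2 * (1 - (cmod z)\<^sup>2) powr \<beta>) \<partial>disc_area)"

text \<open>
  By rotation invariance the integral does not change when \<open>h z\<close> is replaced by \<open>h (cis s * z)\<close>. Averaging
  over \<open>s\<close> and exchanging the integrals turns \<open>|h|\<^sup>2\<close> into its mean over circles, which Parseval's identity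
  expresses by the Taylor coefficients; what remains are radial moments.
\<close>

lemma bergman_integral_eq_Beta:
  assumes h: "h holomorphic_on unit_disc" and \<beta>: "\<beta> > -1"
  shows "bergman_integral \<beta> h
           = (\<Sum>n. ennreal ((cmod (taylor_coeff h n))\<^sup>2 * (pi * Beta (real n + 1) (\<beta> + 1))))"
proof -
  define w where "w z = ennreal ((1 - (cmod z)\<^sup>2) powr \<beta>)" for z :: complex
  have [measurable]: "h \<in> borel_measurable (restrict_space borel unit_disc)"
    by (rule holomorphic_borel_measurable_disc[OF h])
  have [measurable]: "w \<in> borel_measurable (restrict_space borel unit_disc)"
    unfolding w_def by measurable
  interpret disc: sigma_finite_measure disc_area
    by (intro sigma_finite_measure_restrict_space) (auto simp: lborel.sigma_finite_measure_axioms)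
  interpret pair_sigma_finite disc_area lborel ..
  have rot: "(\<integral>\<^sup>+z. ennreal ((cmod (h (cis s * z)))\<^sup>2) * w z \<partial>disc_area) = bergman_integral \<beta> h" for s
  proof -
    have "(\<integral>\<^sup>+z. ennreal ((cmod (h (cis s * z)))\<^sup>2) * w z \<partial>disc_area)
        = (\<integral>\<^sup>+z. ennreal ((cmod (h (cis s * z)))\<^sup>2) * w (cis s * z) \<partial>disc_area)"
      by (simp add: w_def norm_mult)
    also have "\<dots> = (\<integral>\<^sup>+z. ennreal ((cmod (h z))\<^sup>2) * w z \<partial>disc_area)"
      by (rule nn_integral_disc_rotate) auto
    finally show ?thesis by (simp add: bergman_integral_def w_def ennreal_mult')
  qed
  have "bergman_integral \<beta> h = (\<integral>\<^sup>+(t::real). bergman_integral \<beta> h * indicator {0..1} t \<partial>lborel)"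
    by (subst nn_integral_cmult_indicator) auto
  also have "\<dots> = (\<integral>\<^sup>+t. \<integral>\<^sup>+z. ennreal ((cmod (h (cis (2 * pi * t) * z)))\<^sup>2) * indicator {0..1} t *
      w z \<partial>disc_area \<partial>lborel)"
  proof (rule nn_integral_cong)
    fix t :: real
    show "bergman_integral \<beta> h * indicator {0..1} t
        = (\<integral>\<^sup>+z. ennreal ((cmod (h (cis (2 * pi * t) * z)))\<^sup>2) * indicator {0..1} t * w z \<partial>disc_area)"
      using rot[of "2 * pi * t"] by (cases "t \<in> {0..1}") simp_all
  qed
  also have "\<dots> = (\<integral>\<^sup>+z. \<integral>\<^sup>+t. ennreal ((cmod (h (cis (2 * pi * t) * z)))\<^sup>2) * indicator {0..1} t *
      w z \<partial>lborel \<partial>disc_area)"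
  proof (rule Fubini')
    show "(\<lambda>(z, t). ennreal ((cmod (h (cis (2 * pi * t) * z)))\<^sup>2) * indicator {0..1} t * w z)
        \<in> borel_measurable (disc_area \<Otimes>\<^sub>M lborel)"
    proof -
      have "(\<lambda>p. cis (2 * pi * snd p) * fst p) \<in> disc_area \<Otimes>\<^sub>M lborel \<rightarrow>\<^sub>M restrict_space borel
          unit_disc"
      proof (rule measurable_restrict_space2)
        have "fst \<in> disc_area \<Otimes>\<^sub>M (lborel :: real measure) \<rightarrow>\<^sub>M borel"
          by (rule measurable_compose[OF measurable_fst]) measurable
        moreover have "(\<lambda>t. cis (2 * pi * t)) \<in> borel_measurable borel"
          by (intro borel_measurable_continuous_onI continuous_intros)
        then have "(\<lambda>p. cis (2 * pi * snd p)) \<in> disc_area \<Otimes>\<^sub>M (lborel :: real measure) \<rightarrow>\<^sub>M borel"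
          by (rule measurable_compose[rotated]) simp
        ultimately show "(\<lambda>p. cis (2 * pi * snd p) * fst p) \<in> borel_measurable (disc_area \<Otimes>\<^sub>M lborel)"
          by (intro borel_measurable_times)
      qed (auto simp: space_pair_measure space_disc_area norm_mult)
      then have [measurable]: "(\<lambda>p. h (cis (2 * pi * snd p) * fst p))
          \<in> borel_measurable (disc_area \<Otimes>\<^sub>M lborel)"
        by (rule measurable_compose) measurable
      have [measurable]: "(\<lambda>p. w (fst p)) \<in> borel_measurable (disc_area \<Otimes>\<^sub>M (lborel :: real measure))"
        by (rule measurable_compose[OF measurable_fst]) measurable
      have [measurable]: "(\<lambda>p. indicator {0..1} (snd p) :: ennreal)
          \<in> borel_measurable (disc_area \<Otimes>\<^sub>M (lborel :: real measure))"
        by (rule measurable_compose[OF measurable_snd]) measurable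
      show ?thesis unfolding split_beta by measurable
    qed
  qed
  also have "\<dots> = (\<integral>\<^sup>+z. (\<Sum>n. ennreal ((cmod (taylor_coeff h n))\<^sup>2 * cmod z ^ (2 * n))) * w z
      \<partial>disc_area)"
  proof (rule nn_integral_cong)
    fix z assume "z \<in> space disc_area"
    then have z: "z \<in> unit_disc" by (simp add: space_disc_area)
    have cont: "continuous_on UNIV (\<lambda>t. h (cis (2 * pi * t) * z))"
      by (rule continuous_on_compose2[OF holomorphic_on_imp_continuous_on[OF h]])
         (use z in \<open>auto intro!: continuous_intros simp: norm_mult\<close>)
    have [measurable]: "(\<lambda>t. h (cis (2 * pi * t) * z)) \<in> borel_measurable borel"
      by (rule borel_measurable_continuous_onI[OF cont])
    show "(\<integral>\<^sup>+t. ennreal ((cmod (h (cis (2 * pi * t) * z)))\<^sup>2) * indicator {0..1} t * w z \<partial>lborel)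
        = (\<Sum>n. ennreal ((cmod (taylor_coeff h n))\<^sup>2 * cmod z ^ (2 * n))) * w z"
      by (subst nn_integral_multc) (auto simp: nn_integral_circle_Parseval[OF h z])
  qed
  also have "\<dots> = (\<integral>\<^sup>+z. (\<Sum>n. ennreal ((cmod (taylor_coeff h n))\<^sup>2) * ennreal (cmod z ^ (2 * n) *
      (1 - (cmod z)\<^sup>2) powr \<beta>)) \<partial>disc_area)"
    by (simp add: ennreal_suminf_multc[symmetric] w_def ennreal_mult' mult.assoc)
  also have "\<dots> = (\<Sum>n. \<integral>\<^sup>+z. ennreal ((cmod (taylor_coeff h n))\<^sup>2) * ennreal (cmod z ^ (2 * n) * (1
      - (cmod z)\<^sup>2) powr \<beta>) \<partial>disc_area)"
    by (rule nn_integral_suminf) measurable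
  also have "\<dots> = (\<Sum>n. ennreal ((cmod (taylor_coeff h n))\<^sup>2) * ennreal (pi * Beta (real n + 1) (\<beta> + 1)))"
    by (subst nn_integral_cmult) (simp_all only: nn_integral_disc_radial_power[OF \<beta>], measurable)
  finally show ?thesis by (simp add: ennreal_mult')
qed

section \<open>Weighted Dirichlet norms as area integrals\<close>

text \<open>
  \<open>Beta (n + 1) b = n! / (b (b + 1) \<dots> (b + n))\<close>, which is Gauss's product for \<open>Gamma b\<close> up to the
  factor \<open>n powr (- b)\<close>.
\<close>

lemma Beta_asymptotic:
  assumes b: "b > (0::real)"
  shows "(\<lambda>n. Beta (real n + 1) b * (real n + 1) powr b) \<longlonglongrightarrow> Gamma b"
proof -
  have "(\<lambda>n. Gamma_series b n * (real (Suc n) / real n) powr b) \<longlonglongrightarrow> Gamma b * 1 powr b"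
    by (intro tendsto_intros LIMSEQ_Suc_n_over_n) auto
  moreover have "\<forall>\<^sub>F n in sequentially. Gamma_series b n * (real (Suc n) / real n) powr b
      = Beta (real n + 1) b * (real n + 1) powr b"
    using eventually_gt_at_top[of 0]
  proof eventually_elim
    case (elim n)
    have nz: "b \<notin> \<int>\<^sub>\<le>\<^sub>0" using b by (auto elim!: nonpos_Ints_cases)
    have "pochhammer b (n + 1) = Gamma (b + real (n + 1)) / Gamma b"
      by (rule pochhammer_Gamma[OF nz])
    moreover have "Gamma b \<noteq> 0" "Gamma (b + real (n + 1)) \<noteq> 0"
      using b by (auto intro!: less_imp_neq[symmetric] Gamma_real_pos)
    moreover have "Gamma (real n + 1) = fact n"
      using Gamma_fact[of n, where 'a = real] by (simp add: add.commute)
    ultimately have "Beta (real n + 1) b = fact n / pochhammer b (n + 1)"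
      by (simp add: Beta_def add_ac del: pochhammer_Suc)
    moreover have "exp (b * ln (real n)) = real n powr b"
      using elim by (simp add: powr_def)
    moreover have "(real (Suc n) / real n) powr b = (real n + 1) powr b / real n powr b"
      using elim by (simp add: powr_divide add.commute)
    ultimately show ?case
      using elim by (simp add: Gamma_series_def)
  qed
  ultimately show ?thesis by (auto dest: Lim_transform_eventually)
qed

text \<open>
  A sequence of positive numbers with a positive limit is bounded, and so is the sequence of its inverses.
\<close>

lemma Beta_bounds:
  assumes b: "b > (0::real)"
  obtains c where "c > 0" "\<And>n. Beta (real n + 1) b \<le> c * (real n + 1) powr (- b)"
    "\<And>n. (real n + 1) powr (- b) \<le> c * Beta (real n + 1) b"
proof -
  define r where "r n = Beta (real n + 1) b * (real n + 1) powr b" for n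
  have lim: "r \<longlonglongrightarrow> Gamma b"
    unfolding r_def by (rule Beta_asymptotic[OF b])
  have pos: "r n > 0" for n
    using b by (simp add: r_def Beta_def)
  have "(\<lambda>n. inverse (r n)) \<longlonglongrightarrow> inverse (Gamma b)"
    using Gamma_real_pos[OF b] by (intro tendsto_inverse lim) linarith
  then have "Bseq (\<lambda>n. inverse (r n))" "Bseq r"
    using lim by (auto intro!: convergent_imp_Bseq convergentI)
  then obtain c d where c: "c > 0" "\<And>n. norm (inverse (r n)) \<le> c" and d: "d > 0" "\<And>n. norm (r n) \<le> d"
    by (metis BseqE)
  show ?thesis
  proof (rule that[of "max c d"])
    show "max c d > 0" using c by auto
    fix n
    have e: "(real n + 1) powr (- b) * (real n + 1) powr b = 1"
      by (simp add: powr_add[symmetric])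
    have p: "(real n + 1) powr (- b) > 0" by simp
    have B: "Beta (real n + 1) b = r n * (real n + 1) powr (- b)"
      using e by (simp add: r_def mult.assoc) (simp add: mult.commute)
    have "r n \<le> max c d"
      using d(2)[of n] pos[of n] by auto
    then show "Beta (real n + 1) b \<le> max c d * (real n + 1) powr (- b)"
      unfolding B using p by (intro mult_right_mono) auto
    have "1 / r n \<le> max c d"
      using c(2)[of n] pos[of n] by (auto simp: divide_inverse)
    then have "1 \<le> max c d * r n"
      using pos[of n] by (simp add: field_simps)
    from mult_right_mono[OF this less_imp_le[OF p]]
    show "(real n + 1) powr (- b) \<le> max c d * Beta (real n + 1) b"
      unfolding B by (simp add: mult.assoc)
  qed
qed

text \<open>
  For holomorphic functions this is the square of \<open>dirichlet_norm\<close>, with the value \<open>\<infinity>\<close> outside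
  of the Dirichlet space.
\<close>

definition dirichlet_energy :: "real \<Rightarrow> (complex \<Rightarrow> complex) \<Rightarrow> ennreal" where
  "dirichlet_energy \<alpha> f = (\<Sum>n. ennreal (dirichlet_term \<alpha> f n))"

lemma dirichlet_term_nonneg: "dirichlet_term \<alpha> f n \<ge> 0"
  by (simp add: dirichlet_term_def)

lemma suminf_ennreal_le_cmult:
  assumes "\<And>n. f n \<le> c * g n" "c \<ge> 0"
  shows "(\<Sum>n. ennreal (f n)) \<le> ennreal c * (\<Sum>n. ennreal (g n))"
  unfolding ennreal_suminf_cmult[symmetric] ennreal_mult'[OF assms(2), symmetric]
  by (intro suminf_le summableI ennreal_leI assms)

text \<open>
  The Bergman space with exponent \<open>\<beta>\<close> is the Dirichlet space with parameter
  \<open>\<beta> + 2\<close>: both weigh \<open>|a n|\<^sup>2\<close> by \<open>(n + 1) powr (- \<beta> - 1)\<close>.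
\<close>

lemma bergman_integral_equiv_energy:
  assumes "\<beta> > -1"
  shows "\<exists>C. \<forall>h. h holomorphic_on unit_disc \<longrightarrow>
           bergman_integral \<beta> h \<le> ennreal C * dirichlet_energy (\<beta> + 2) h \<and>
           dirichlet_energy (\<beta> + 2) h \<le> ennreal C * bergman_integral \<beta> h"
proof -
  obtain c where c: "c > 0" "\<And>n. Beta (real n + 1) (\<beta> + 1) \<le> c * (real n + 1) powr (- (\<beta> + 1))"
    "\<And>n. (real n + 1) powr (- (\<beta> + 1)) \<le> c * Beta (real n + 1) (\<beta> + 1)"
    using Beta_bounds[of "\<beta> + 1"] assms by auto
  have e: "1 - (\<beta> + 2) = - (\<beta> + 1)" by simp
  show ?thesis
  proof (intro exI[of _ "pi * c"] allI impI conjI)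
    fix h assume h: "h holomorphic_on unit_disc"
    show "bergman_integral \<beta> h \<le> ennreal (pi * c) * dirichlet_energy (\<beta> + 2) h"
      unfolding bergman_integral_eq_Beta[OF h assms] dirichlet_energy_def
    proof (rule suminf_ennreal_le_cmult)
      fix n
      have "(cmod (taylor_coeff h n))\<^sup>2 * pi * Beta (real n + 1) (\<beta> + 1)
          \<le> (cmod (taylor_coeff h n))\<^sup>2 * pi * (c * (real n + 1) powr (- (\<beta> + 1)))"
        by (intro mult_left_mono c) auto
      then show "(cmod (taylor_coeff h n))\<^sup>2 * (pi * Beta (real n + 1) (\<beta> + 1))
          \<le> pi * c * dirichlet_term (\<beta> + 2) h n"
        unfolding dirichlet_term_def e by (simp add: mult_ac add.commute)
    qed (use c in auto)
    have "dirichlet_energy (\<beta> + 2) h \<le> ennreal (c / pi) * bergman_integral \<beta> h"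
      unfolding bergman_integral_eq_Beta[OF h assms] dirichlet_energy_def
    proof (rule suminf_ennreal_le_cmult)
      fix n
      have "(cmod (taylor_coeff h n))\<^sup>2 * (real n + 1) powr (- (\<beta> + 1))
          \<le> (cmod (taylor_coeff h n))\<^sup>2 * (c * Beta (real n + 1) (\<beta> + 1))"
        by (intro mult_left_mono c) auto
      then show "dirichlet_term (\<beta> + 2) h n
          \<le> c / pi * ((cmod (taylor_coeff h n))\<^sup>2 * (pi * Beta (real n + 1) (\<beta> + 1)))"
        unfolding dirichlet_term_def e by (simp add: mult_ac add.commute)
    qed (use c in auto)
    also have "\<dots> \<le> ennreal (pi * c) * bergman_integral \<beta> h"
    proof (intro mult_right_mono ennreal_leI)
      have "1 \<le> pi * pi" using pi_gt3 mult_mono[of 1 pi 1 pi] by auto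
      then show "c / pi \<le> pi * c" using c by (simp add: field_simps)
    qed auto
    finally show "dirichlet_energy (\<beta> + 2) h \<le> ennreal (pi * c) * bergman_integral \<beta> h" .
  qed
qed

lemma taylor_coeff_deriv: "taylor_coeff (deriv h) n = of_nat (Suc n) * taylor_coeff h (Suc n)"
  by (simp add: fps_expansion_def funpow_swap1 field_simps del: of_nat_Suc)

text \<open>
  Differentiation shifts the Taylor coefficients by one, which moves the weights by one place; this costs
  only a constant because \<open>1 \<le> (n + 2) / (n + 1) \<le> 2\<close>.
\<close>

lemma powr_Suc_bounds:
  fixes s :: real
  shows "real (n + 1) powr s \<le> 2 powr \<bar>s\<bar> * real (n + 2) powr s"
    and "real (n + 2) powr s \<le> 2 powr \<bar>s\<bar> * real (n + 1) powr s"
proof -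
  define q where "q = real (n + 2) / real (n + 1)"
  have q: "1 \<le> q" "q \<le> 2" by (simp_all add: q_def field_simps)
  have "q powr s \<le> q powr \<bar>s\<bar>" "q powr (- s) \<le> q powr \<bar>s\<bar>"
    using q by (auto intro!: powr_mono)
  moreover have "q powr \<bar>s\<bar> \<le> 2 powr \<bar>s\<bar>"
    using q by (intro powr_mono2) auto
  ultimately have b: "q powr s \<le> 2 powr \<bar>s\<bar>" "q powr (- s) \<le> 2 powr \<bar>s\<bar>" by linarith+
  have e: "q powr s = real (n + 2) powr s / real (n + 1) powr s"
    unfolding q_def by (rule powr_divide)
  show "real (n + 2) powr s \<le> 2 powr \<bar>s\<bar> * real (n + 1) powr s"
    using b(1) unfolding e by (simp add: field_simps)
  have "q powr (- s) = real (n + 1) powr s / real (n + 2) powr s"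
    unfolding powr_minus e by simp
  with b(2) have "real (n + 1) powr s / real (n + 2) powr s \<le> 2 powr \<bar>s\<bar>"
    by simp
  then show "real (n + 1) powr s \<le> 2 powr \<bar>s\<bar> * real (n + 2) powr s"
    by (subst (asm) pos_divide_le_eq) auto
qed

text \<open>
  The factor \<open>(n + 1)\<^sup>2\<close> from differentiating raises the exponent of the weight by 2, exactly what the
  parameter \<open>\<alpha> + 2\<close> takes away.
\<close>

lemma dirichlet_term_deriv:
  "dirichlet_term (\<alpha> + 2) (deriv h) n = real (n + 1) powr (1 - \<alpha>) * (cmod (taylor_coeff h (Suc n)))\<^sup>2"
proof -
  have "1 - \<alpha> = (1 - (\<alpha> + 2)) + 2" by simp
  then have "real (n + 1) powr (1 - \<alpha>) = real (n + 1) powr (1 - (\<alpha> + 2)) * (real (n + 1))\<^sup>2"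
    by (metis powr_add powr_numeral of_nat_0_le_iff)
  then show ?thesis
    by (simp add: dirichlet_term_def taylor_coeff_deriv norm_mult power_mult_distrib del: of_nat_Suc)
qed

lemma dirichlet_energy_split:
  "dirichlet_energy \<alpha> h = ennreal ((cmod (h 0))\<^sup>2) + (\<Sum>n. ennreal (dirichlet_term \<alpha> h (Suc n)))"
proof -
  have "dirichlet_term \<alpha> h 0 = (cmod (h 0))\<^sup>2"
    by (simp add: dirichlet_term_def fps_expansion_def)
  then show ?thesis
    unfolding dirichlet_energy_def
    using suminf_offset[of "\<lambda>n. ennreal (dirichlet_term \<alpha> h n)" 1] by (simp add: add.commute)
qed

lemma dirichlet_energy_deriv_le:
  "dirichlet_energy (\<alpha> + 2) (deriv h) \<le> ennreal (2 powr \<bar>1 - \<alpha>\<bar>) * dirichlet_energy \<alpha> h"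
proof -
  have "dirichlet_energy (\<alpha> + 2) (deriv h) \<le> ennreal (2 powr \<bar>1 - \<alpha>\<bar>) * (\<Sum>n. ennreal
      (dirichlet_term \<alpha> h (Suc n)))"
    unfolding dirichlet_energy_def
  proof (rule suminf_ennreal_le_cmult)
    fix n
    show "dirichlet_term (\<alpha> + 2) (deriv h) n \<le> 2 powr \<bar>1 - \<alpha>\<bar> * dirichlet_term \<alpha> h (Suc n)"
      using mult_right_mono[OF powr_Suc_bounds(1)[of n "1 - \<alpha>"], of "(cmod (taylor_coeff h (Suc n)))\<^sup>2"]
      unfolding dirichlet_term_deriv by (simp add: dirichlet_term_def mult.assoc)
  qed auto
  also have "\<dots> \<le> ennreal (2 powr \<bar>1 - \<alpha>\<bar>) * dirichlet_energy \<alpha> h"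
    unfolding dirichlet_energy_split[of \<alpha>] by (intro mult_left_mono) auto
  finally show ?thesis .
qed

lemma dirichlet_energy_le_deriv:
  "dirichlet_energy \<alpha> h \<le> ennreal ((cmod (h 0))\<^sup>2)
     + ennreal (2 powr \<bar>1 - \<alpha>\<bar>) * dirichlet_energy (\<alpha> + 2) (deriv h)"
  unfolding dirichlet_energy_split[of \<alpha>]
proof (rule add_left_mono)
  show "(\<Sum>n. ennreal (dirichlet_term \<alpha> h (Suc n))) \<le> ennreal (2 powr \<bar>1 - \<alpha>\<bar>) * dirichlet_energy
      (\<alpha> + 2) (deriv h)"
    unfolding dirichlet_energy_def
  proof (rule suminf_ennreal_le_cmult)
    fix n
    show "dirichlet_term \<alpha> h (Suc n) \<le> 2 powr \<bar>1 - \<alpha>\<bar> * dirichlet_term (\<alpha> + 2) (deriv h) n"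
      using mult_right_mono[OF powr_Suc_bounds(2)[of n "1 - \<alpha>"], of "(cmod (taylor_coeff h (Suc n)))\<^sup>2"]
      unfolding dirichlet_term_deriv by (simp add: dirichlet_term_def mult.assoc)
  qed auto
qed

lemma dirichlet_energy_antimono:
  assumes "\<alpha> \<le> \<beta>" shows "dirichlet_energy \<beta> h \<le> dirichlet_energy \<alpha> h"
  unfolding dirichlet_energy_def dirichlet_term_def using assms
  by (intro suminf_le summableI ennreal_leI mult_right_mono powr_mono) auto

lemma summable_powr_power:
  fixes s r :: real
  assumes "0 \<le> r" "r < 1"
  shows "summable (\<lambda>n. real (n + 1) powr s * r ^ n)"
proof -
  have "(\<lambda>n. real (Suc n) / real (Suc (Suc n))) \<longlonglongrightarrow> 1"
    using LIMSEQ_Suc[OF LIMSEQ_n_over_Suc_n] by simp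
  then have "(\<lambda>n. (real (Suc n) / real (Suc (Suc n))) powr s) \<longlonglongrightarrow> 1 powr s"
    by (intro tendsto_powr tendsto_const) auto
  then have "(\<lambda>n. norm (real (n + 1) powr s) / norm (real (Suc n + 1) powr s)) \<longlonglongrightarrow> 1"
    by (simp add: powr_divide del: of_nat_Suc)
  then have "conv_radius (\<lambda>n. real (n + 1) powr s) = 1"
    by (intro conv_radius_ratio_limit[where c = 1]) (auto simp: one_ereal_def)
  then show ?thesis
    using assms by (intro summable_in_conv_radius) (simp add: one_ereal_def)
qed

text \<open>
  A finite energy \<open>e\<close> bounds each coefficient by \<open>sqrt e * (n + 1) powr (- s)\<close> with \<open>s = (1 - \<alpha>) / 2\<close>,
  and with these bounds the Taylor series is dominated at \<open>p\<close> by \<open>sqrt e\<close> times a convergent series of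
  value \<open>K\<close>. The constant is \<open>1 + K\<^sup>2\<close> instead of \<open>K\<^sup>2\<close> because it has to be positive when the
  energy is infinite.
\<close>

lemma point_evaluation_le_energy:
  assumes p: "p \<in> unit_disc"
  shows "\<exists>C. \<forall>h. h holomorphic_on unit_disc \<longrightarrow> ennreal ((cmod (h p))\<^sup>2)
      \<le> ennreal C * dirichlet_energy \<alpha> h"
proof -
  define s where "s = (1 - \<alpha>) / 2"
  define K where "K = (\<Sum>n. real (n + 1) powr (- s) * cmod p ^ n)"
  have sm: "summable (\<lambda>n. real (n + 1) powr (- s) * cmod p ^ n)"
    using p by (intro summable_powr_power) auto
  have K0: "K \<ge> 0" unfolding K_def by (intro suminf_nonneg sm) auto
  show ?thesis
  proof (intro exI[of _ "1 + K\<^sup>2"] allI impI)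
    fix h assume h: "h holomorphic_on unit_disc"
    show "ennreal ((cmod (h p))\<^sup>2) \<le> ennreal (1 + K\<^sup>2) * dirichlet_energy \<alpha> h"
    proof (cases "dirichlet_energy \<alpha> h")
      case top
      then show ?thesis by (simp add: ennreal_mult_top add_pos_nonneg)
    next
      case (real e)
      have a: "cmod (taylor_coeff h n) \<le> sqrt e * real (n + 1) powr (- s)" for n
      proof -
        have s2: "1 - \<alpha> = s * 2" by (simp add: s_def)
        have "ennreal (dirichlet_term \<alpha> h n) \<le> dirichlet_energy \<alpha> h"
          unfolding dirichlet_energy_def using sum_le_suminf[OF summableI, of "{n}"
              "\<lambda>n. ennreal (dirichlet_term \<alpha> h n)"] by simp
        then have "dirichlet_term \<alpha> h n \<le> e"
          using real by simp
        moreover have "dirichlet_term \<alpha> h n = (real (n + 1) powr s * cmod (taylor_coeff h n))\<^sup>2"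
          unfolding dirichlet_term_def s2 by (simp add: power_mult_distrib powr_power mult.commute)
        ultimately have "real (n + 1) powr s * cmod (taylor_coeff h n) \<le> sqrt e"
          by (simp add: real_le_rsqrt)
        then show ?thesis by (simp add: powr_minus field_simps)
      qed
      have "cmod (h p) = cmod (\<Sum>n. taylor_coeff h n * p ^ n)"
        using taylor_coeff_sums[OF h p] by (simp add: sums_iff)
      also have "\<dots> \<le> (\<Sum>n. cmod (taylor_coeff h n * p ^ n))"
        by (rule summable_norm[OF summable_norm_taylor[OF h p]])
      also have "\<dots> \<le> (\<Sum>n. sqrt e * (real (n + 1) powr (- s) * cmod p ^ n))"
        using mult_right_mono[OF a, of "cmod p ^ n" for n]
        by (intro suminf_le summable_norm_taylor[OF h p] summable_mult sm)
            (simp add: norm_mult norm_power mult.assoc)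
      also have "\<dots> = sqrt e * K"
        unfolding K_def by (rule suminf_mult[OF sm])
      finally have "(cmod (h p))\<^sup>2 \<le> (sqrt e * K)\<^sup>2"
        by (intro power_mono) auto
      also have "\<dots> \<le> (1 + K\<^sup>2) * e"
        using real by (simp add: power_mult_distrib algebra_simps)
      finally show ?thesis
        unfolding real(2) using real(1) by (subst ennreal_mult[symmetric]) (auto intro: ennreal_leI)
    qed
  qed
qed

section \<open>Quantities controlled by the Dirichlet norm\<close>

text \<open>
  The rules for this predicate combine partial estimates and keep their constants out of sight.
\<close>

definition energy_dominated :: "real \<Rightarrow> ((complex \<Rightarrow> complex) \<Rightarrow> ennreal) \<Rightarrow> bool" where
  "energy_dominated \<alpha> X \<longleftrightarrow>
     (\<exists>C. C < \<infinity> \<and> (\<forall>f. f holomorphic_on unit_disc \<longrightarrow> X f \<le> C * dirichlet_energy \<alpha> f))"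

lemma energy_dominatedI:
  "C < \<infinity> \<Longrightarrow> (\<And>f. f holomorphic_on unit_disc \<Longrightarrow> X f \<le> C * dirichlet_energy \<alpha> f) \<Longrightarrow> energy_dominated \<alpha> X"
  by (auto simp: energy_dominated_def)

lemma energy_dominated_mono:
  assumes "energy_dominated \<alpha> Y" "\<And>f. f holomorphic_on unit_disc \<Longrightarrow> X f \<le> Y f"
  shows "energy_dominated \<alpha> X"
  using assms unfolding energy_dominated_def by (meson order.trans)

lemma energy_dominated_cmult:
  assumes "energy_dominated \<alpha> X" "K < \<infinity>"
  shows "energy_dominated \<alpha> (\<lambda>f. K * X f)"
proof -
  obtain C where "C < \<infinity>" "\<And>f. f holomorphic_on unit_disc \<Longrightarrow> X f \<le> C * dirichlet_energy \<alpha> f"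
    using assms by (auto simp: energy_dominated_def)
  then show ?thesis
    using assms(2) by (intro energy_dominatedI[of "K * C"])
      (auto simp: ennreal_mult_less_top mult.assoc intro!: mult_left_mono)
qed

lemma energy_dominated_add:
  assumes "energy_dominated \<alpha> X" "energy_dominated \<alpha> Y"
  shows "energy_dominated \<alpha> (\<lambda>f. X f + Y f)"
proof -
  obtain C D where "C < \<infinity>" "\<And>f. f holomorphic_on unit_disc \<Longrightarrow> X f \<le> C * dirichlet_energy \<alpha> f"
    "D < \<infinity>" "\<And>f. f holomorphic_on unit_disc \<Longrightarrow> Y f \<le> D * dirichlet_energy \<alpha> f"
    using assms by (auto simp: energy_dominated_def)
  then show ?thesis
    by (intro energy_dominatedI[of "C + D"]) (auto simp: distrib_right intro!: add_mono)
qed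

text \<open>
  The Dirichlet norms decrease as the parameter grows.
\<close>

lemma energy_dominated_weaken:
  assumes "energy_dominated \<beta> X" "\<alpha> \<le> \<beta>"
  shows "energy_dominated \<alpha> X"
proof -
  obtain C where "C < \<infinity>" "\<And>f. f holomorphic_on unit_disc \<Longrightarrow> X f \<le> C * dirichlet_energy \<beta> f"
    using assms by (auto simp: energy_dominated_def)
  then show ?thesis
    using mult_left_mono[OF dirichlet_energy_antimono[OF assms(2)]]
    by (intro energy_dominatedI[of C]) (auto intro: order.trans)
qed

lemma energy_dominated_deriv:
  assumes "energy_dominated (\<alpha> + 2) X"
  shows "energy_dominated \<alpha> (\<lambda>f. X (deriv f))"
proof -
  obtain C where C: "C < \<infinity>" "\<And>f. f holomorphic_on unit_disc \<Longrightarrow> X f \<le> C * dirichlet_energy (\<alpha> + 2) f"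
    using assms by (auto simp: energy_dominated_def)
  show ?thesis
  proof (rule energy_dominatedI[of "C * ennreal (2 powr \<bar>1 - \<alpha>\<bar>)"])
    show "C * ennreal (2 powr \<bar>1 - \<alpha>\<bar>) < \<infinity>" using C(1) by (simp add: ennreal_mult_less_top)
    fix f assume "f holomorphic_on unit_disc"
    then have "deriv f holomorphic_on unit_disc" by (intro holomorphic_deriv) auto
    from C(2)[OF this] show "X (deriv f) \<le> C * ennreal (2 powr \<bar>1 - \<alpha>\<bar>) * dirichlet_energy \<alpha> f"
      using mult_left_mono[OF dirichlet_energy_deriv_le, of C \<alpha> f] by (simp add: mult.assoc)
  qed
qed

lemma energy_dominated_bergman:
  assumes "\<beta> > -1"
  shows "energy_dominated (\<beta> + 2) (bergman_integral \<beta>)"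
proof -
  obtain C where C: "\<And>f. f holomorphic_on unit_disc \<Longrightarrow> bergman_integral \<beta> f
      \<le> ennreal C * dirichlet_energy (\<beta> + 2) f"
    using bergman_integral_equiv_energy[OF assms] by blast
  from C show ?thesis by (intro energy_dominatedI[of "ennreal C"]) auto
qed

lemma energy_dominated_point:
  assumes "p \<in> unit_disc"
  shows "energy_dominated \<alpha> (\<lambda>f. ennreal ((cmod (f p))\<^sup>2))"
proof -
  obtain C where C: "\<And>f. f holomorphic_on unit_disc \<Longrightarrow> ennreal ((cmod (f p))\<^sup>2)
      \<le> ennreal C * dirichlet_energy \<alpha> f"
    using point_evaluation_le_energy[OF assms] by blast
  from C show ?thesis by (intro energy_dominatedI[of "ennreal C"]) auto
qed

section \<open>Composition with a univalent self-map\<close>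

text \<open>
  Let \<open>m\<close> be the disc automorphism that sends \<open>a = \<phi> 0\<close> to 0. The Schwarz lemma bounds \<open>|m (\<phi> z)|\<close> by
  \<open>|z|\<close>, and \<open>1 - |m w|\<^sup>2 = (1 - |a|\<^sup>2) (1 - |w|\<^sup>2) / |1 - cnj a * w|\<^sup>2\<close>, where the denominator is at least
  \<open>(1 - |a|)\<^sup>2\<close>.
\<close>

lemma Schwarz_Pick_boundary_distance:
  assumes hol: "\<phi> holomorphic_on unit_disc" and maps: "\<phi> ` unit_disc \<subseteq> unit_disc"
  shows "\<exists>K>0. \<forall>z\<in>unit_disc. 1 - (cmod z)\<^sup>2 \<le> K * (1 - (cmod (\<phi> z))\<^sup>2)"
proof -
  define a where "a = \<phi> 0"
  have a: "cmod a < 1" using maps by (force simp: a_def)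
  define m where "m = Moebius_function 0 a"
  have m_hol: "m holomorphic_on unit_disc"
    unfolding m_def by (rule Moebius_function_holomorphic[OF a])
  have comp_hol: "(m \<circ> \<phi>) holomorphic_on unit_disc"
    by (rule holomorphic_on_compose_gen[OF hol m_hol maps])
  have bound: "cmod (m (\<phi> z)) \<le> cmod z" if "z \<in> unit_disc" for z
  proof -
    have "cmod ((m \<circ> \<phi>) z) \<le> cmod z"
    proof (rule Schwarz_Lemma(1)[OF comp_hol])
      show "(m \<circ> \<phi>) 0 = 0" by (simp add: m_def a_def Moebius_function_eq_zero)
      fix z :: complex assume "cmod z < 1"
      then have "cmod (\<phi> z) < 1" using maps by (force simp: image_subset_iff)
      then show "cmod ((m \<circ> \<phi>) z) < 1"
        by (simp add: m_def Moebius_function_norm_lt_1[OF a])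
    qed (use that in auto)
    then show ?thesis by simp
  qed
  show ?thesis
  proof (intro exI[of _ "(1 - (cmod a)\<^sup>2) / (1 - cmod a)\<^sup>2"] conjI ballI)
    have a2: "(cmod a)\<^sup>2 < 1" using a power_strict_mono[of "cmod a" 1 2] by simp
    then show "(1 - (cmod a)\<^sup>2) / (1 - cmod a)\<^sup>2 > 0" using a by simp
    fix z :: complex assume z: "z \<in> unit_disc"
    define w where "w = \<phi> z"
    have w: "cmod w < 1" using z maps by (force simp: w_def)
    have w2: "(cmod w)\<^sup>2 < 1" using w power_strict_mono[of "cmod w" 1 2] by simp
    have "cmod (cnj a * w) \<le> cmod a"
      using w by (simp add: norm_mult mult_left_le)
    then have d: "1 - cmod a \<le> cmod (1 - cnj a * w)"
      using norm_triangle_ineq2[of 1 "cnj a * w"] by simp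
    then have nz: "1 - cnj a * w \<noteq> 0" using a by auto
    have id: "(cmod (1 - cnj a * w))\<^sup>2 - (cmod (w - a))\<^sup>2 = (1 - (cmod a)\<^sup>2) * (1 - (cmod w)\<^sup>2)"
      unfolding cmod_power2 by (simp add: algebra_simps power2_eq_square)
    have "1 - (cmod z)\<^sup>2 \<le> 1 - (cmod (m w))\<^sup>2"
      using bound[OF z] by (simp add: w_def power_mono)
    also have "\<dots> = (1 - (cmod a)\<^sup>2) * (1 - (cmod w)\<^sup>2) / (cmod (1 - cnj a * w))\<^sup>2"
    proof -
      have "(cmod (m w))\<^sup>2 = (cmod (w - a))\<^sup>2 / (cmod (1 - cnj a * w))\<^sup>2"
        by (simp add: m_def Moebius_function_simple norm_divide power_divide)
      then show ?thesis
        using nz unfolding id[symmetric] by (simp add: diff_divide_distrib)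
    qed
    also have "\<dots> \<le> (1 - (cmod a)\<^sup>2) * (1 - (cmod w)\<^sup>2) / (1 - cmod a)\<^sup>2"
      using a a2 w2 d by (intro divide_left_mono power_mono mult_nonneg_nonneg)
          (auto intro!: mult_pos_pos)
    finally show "1 - (cmod z)\<^sup>2 \<le> (1 - (cmod a)\<^sup>2) / (1 - cmod a)\<^sup>2 * (1 - (cmod (\<phi> z))\<^sup>2)"
      by (simp add: w_def)
  qed
qed

lemma univalent_substitution_le_bergman:
  assumes "holomorphic_self_map \<phi>" "inj_on \<phi> unit_disc" and h: "h holomorphic_on unit_disc"
  shows "(\<integral>\<^sup>+z. ennreal ((cmod (deriv \<phi> z))\<^sup>2 * ((cmod (h (\<phi> z)))\<^sup>2 * (1 - (cmod (\<phi> z))\<^sup>2) powr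
      \<beta>)) \<partial>disc_area)
           \<le> bergman_integral \<beta> h"
proof -
  have [measurable]: "h \<in> borel_measurable (restrict_space borel unit_disc)"
    by (rule holomorphic_borel_measurable_disc[OF h])
  define F where "F = (\<lambda>w. ennreal ((cmod (h w))\<^sup>2 * (1 - (cmod w)\<^sup>2) powr \<beta>))"
  have [measurable]: "F \<in> borel_measurable (restrict_space borel unit_disc)"
    unfolding F_def by measurable
  have "(\<integral>\<^sup>+z. ennreal ((cmod (deriv \<phi> z))\<^sup>2) * F (\<phi> z) \<partial>disc_area) \<le> integral\<^sup>N disc_area F"
    using assms(1,2)
    by (intro nn_integral_univalent_image_le) (simp_all add: holomorphic_self_map_def)
  moreover have "ennreal ((cmod (deriv \<phi> z))\<^sup>2) * F (\<phi> z)
      = ennreal ((cmod (deriv \<phi> z))\<^sup>2 * ((cmod (h (\<phi> z)))\<^sup>2 * (1 - (cmod (\<phi> z))\<^sup>2) powr \<beta>))" for z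
    unfolding F_def by (rule ennreal_mult'[symmetric]) simp
  ultimately show ?thesis
    by (simp only: bergman_integral_def F_def)
qed

text \<open>
  Passing to the derivative of \<open>f \<circ> \<phi>\<close> brings in the Jacobian factor \<open>|\<phi>'|\<^sup>2\<close> that the change of variables
  needs, at the price of two more powers of \<open>1 - |z|\<^sup>2\<close>. By the Schwarz-Pick inequality these
  powers may be evaluated at \<open>\<phi> z\<close>, and the resulting integral of \<open>f'\<close> is again controlled by the
  energy of \<open>f\<close>.
\<close>

lemma energy_dominated_bergman_compose:
  assumes \<phi>: "holomorphic_self_map \<phi>" "inj_on \<phi> unit_disc" and \<beta>: "\<beta> > -1"
  shows "energy_dominated (\<beta> + 2) (\<lambda>f. bergman_integral \<beta> (f \<circ> \<phi>))"
proof -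
  have \<phi>': "\<phi> holomorphic_on unit_disc" "\<phi> ` unit_disc \<subseteq> unit_disc"
    using \<phi> by (auto simp: holomorphic_self_map_def)
  have \<phi>0: "\<phi> 0 \<in> unit_disc" using \<phi>'(2) by force
  have lt1: "(cmod z)\<^sup>2 < 1" if "z \<in> unit_disc" for z :: complex
    using that power_strict_mono[of "cmod z" 1 2] by simp
  obtain K where K: "K > 0" "\<And>z. z \<in> unit_disc \<Longrightarrow> 1 - (cmod z)\<^sup>2 \<le> K * (1 - (cmod (\<phi> z))\<^sup>2)"
    using Schwarz_Pick_boundary_distance[OF \<phi>'] by blast
  obtain C where C: "\<And>h. h holomorphic_on unit_disc \<Longrightarrow> bergman_integral \<beta> h
      \<le> ennreal C * dirichlet_energy (\<beta> + 2) h"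
    using bergman_integral_equiv_energy[OF \<beta>] by blast
  have \<beta>2: "\<beta> + 2 > -1" using \<beta> by simp
  obtain D where D: "\<And>h. h holomorphic_on unit_disc \<Longrightarrow> dirichlet_energy (\<beta> + 2 + 2) h
      \<le> ennreal D * bergman_integral (\<beta> + 2) h"
    using bergman_integral_equiv_energy[OF \<beta>2] by blast
  have deriv_part: "bergman_integral (\<beta> + 2) (deriv (f \<circ> \<phi>))
      \<le> ennreal (K powr (\<beta> + 2)) * bergman_integral (\<beta> + 2) (deriv f)"
    if f: "f holomorphic_on unit_disc" for f
  proof -
    have f': "deriv f holomorphic_on unit_disc" using f by (intro holomorphic_deriv) auto
    have [measurable]: "deriv f \<in> borel_measurable (restrict_space borel unit_disc)"
        "deriv \<phi> \<in> borel_measurable (restrict_space borel unit_disc)"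
        "(\<lambda>z. deriv f (\<phi> z)) \<in> borel_measurable (restrict_space borel unit_disc)"
        "\<phi> \<in> borel_measurable (restrict_space borel unit_disc)"
      using f' \<phi>' holomorphic_on_compose_gen[OF \<phi>'(1) f' \<phi>'(2)]
      by (auto intro!: holomorphic_borel_measurable_disc holomorphic_deriv simp: o_def)
    have "bergman_integral (\<beta> + 2) (deriv (f \<circ> \<phi>)) \<le> 
       (\<integral>\<^sup>+z. ennreal (K powr (\<beta> + 2)) * ennreal ((cmod (deriv \<phi> z))\<^sup>2 * ((cmod (deriv f (\<phi> z)))\<^sup>2
           * (1 - (cmod (\<phi> z))\<^sup>2) powr (\<beta> + 2))) \<partial>disc_area)"
      unfolding bergman_integral_def
    proof (rule nn_integral_mono)
      fix z assume "z \<in> space disc_area"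
      then have z: "z \<in> unit_disc" by (simp add: space_disc_area)
      then have \<phi>z: "\<phi> z \<in> unit_disc" using \<phi>'(2) by blast
      have "deriv (f \<circ> \<phi>) z = deriv f (\<phi> z) * deriv \<phi> z"
        by (intro deriv_chain holomorphic_on_imp_differentiable_at[OF \<phi>'(1) open_ball z]
            holomorphic_on_imp_differentiable_at[OF f open_ball \<phi>z])
      moreover have "(1 - (cmod z)\<^sup>2) powr (\<beta> + 2) \<le> K powr (\<beta> + 2) * (1 - (cmod (\<phi> z))\<^sup>2) powr (\<beta> + 2)"
        using K(2)[OF z] K(1) lt1[OF z] lt1[OF \<phi>z] \<beta>
        by (subst powr_mult[symmetric]) (auto intro!: powr_mono2)
      ultimately show "ennreal ((cmod (deriv (f \<circ> \<phi>) z))\<^sup>2 * (1 - (cmod z)\<^sup>2) powr (\<beta> + 2)) \<le>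
          ennreal (K powr (\<beta> + 2)) * ennreal ((cmod (deriv \<phi> z))\<^sup>2 * ((cmod (deriv f (\<phi> z)))\<^sup>2 *
              (1 - (cmod (\<phi> z))\<^sup>2) powr (\<beta> + 2)))"
        unfolding ennreal_mult'[OF powr_ge_zero, symmetric]
        using mult_left_mono[of "(1 - (cmod z)\<^sup>2) powr (\<beta> + 2)"
            "K powr (\<beta> + 2) * (1 - (cmod (\<phi> z))\<^sup>2) powr (\<beta> + 2)"
            "(cmod (deriv f (\<phi> z)))\<^sup>2 * (cmod (deriv \<phi> z))\<^sup>2"]
        by (intro ennreal_leI) (simp add: norm_mult power_mult_distrib mult_ac)
    qed
    also have "\<dots> = ennreal (K powr (\<beta> + 2)) * (\<integral>\<^sup>+z. ennreal ((cmod (deriv \<phi> z))\<^sup>2 * ((cmod (deriv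
        f (\<phi> z)))\<^sup>2 * (1 - (cmod (\<phi> z))\<^sup>2) powr (\<beta> + 2))) \<partial>disc_area)"
      by (rule nn_integral_cmult) measurable
    also have "\<dots> \<le> ennreal (K powr (\<beta> + 2)) * bergman_integral (\<beta> + 2) (deriv f)"
      by (intro mult_left_mono univalent_substitution_le_bergman \<phi> f') simp
    finally show ?thesis .
  qed
  define E where "E = 2 powr \<bar>1 - (\<beta> + 2)\<bar>"
  have "energy_dominated (\<beta> + 2 + 2) (bergman_integral (\<beta> + 2))"
    using \<beta> by (intro energy_dominated_bergman) simp
  then have "energy_dominated (\<beta> + 2) (\<lambda>f. ennreal C * (ennreal ((cmod (f (\<phi> 0)))\<^sup>2) +
      ennreal E * (ennreal D * (ennreal (K powr (\<beta> + 2)) * bergman_integral (\<beta> + 2) (deriv f)))))"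
    by (intro energy_dominated_cmult energy_dominated_add energy_dominated_point
        energy_dominated_deriv \<phi>0) auto
  then show ?thesis
  proof (rule energy_dominated_mono)
    fix f assume f: "f holomorphic_on unit_disc"
    have c: "f \<circ> \<phi> holomorphic_on unit_disc"
      by (rule holomorphic_on_compose_gen[OF \<phi>'(1) f \<phi>'(2)])
    then have c': "deriv (f \<circ> \<phi>) holomorphic_on unit_disc" by (intro holomorphic_deriv) auto
    have "bergman_integral \<beta> (f \<circ> \<phi>) \<le> ennreal C * dirichlet_energy (\<beta> + 2) (f \<circ> \<phi>)"
      by (rule C[OF c])
    also have "\<dots> \<le> ennreal C * (ennreal ((cmod ((f \<circ> \<phi>) 0))\<^sup>2) + ennreal E * dirichlet_energy (\<beta>
        + 2 + 2) (deriv (f \<circ> \<phi>)))"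
      unfolding E_def by (intro mult_left_mono dirichlet_energy_le_deriv) simp
    also have "\<dots> \<le> ennreal C * (ennreal ((cmod (f (\<phi> 0)))\<^sup>2) +
      ennreal E * (ennreal D * (ennreal (K powr (\<beta> + 2)) * bergman_integral (\<beta> + 2) (deriv f))))"
      using order.trans[OF D[OF c'] mult_left_mono[OF deriv_part[OF f]]]
      by (intro mult_left_mono add_mono) auto
    finally show "bergman_integral \<beta> (f \<circ> \<phi>) \<le> \<dots>" .
  qed
qed

section \<open>Weighted composition operators\<close>

lemma norm_add4_square_le:
  fixes a b c d :: "'a::real_normed_vector"
  shows "(norm (a + b + c + d))\<^sup>2 \<le> 4 * ((norm a)\<^sup>2 + (norm b)\<^sup>2 + (norm c)\<^sup>2 + (norm d)\<^sup>2)"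
proof -
  have "norm (a + b + c + d) \<le> norm a + norm b + norm c + norm d"
    by (intro order.trans[OF norm_triangle_ineq] add_right_mono) simp_all
  then have "(norm (a + b + c + d))\<^sup>2 \<le> (norm a + norm b + norm c + norm d)\<^sup>2"
    by (intro power_mono) auto
  \<comment> \<open>The difference of the two sides is the sum of the squares of the six pairwise differences.\<close>
  also have "\<dots> \<le> 4 * ((norm a)\<^sup>2 + (norm b)\<^sup>2 + (norm c)\<^sup>2 + (norm d)\<^sup>2)"
    using sum_squares_ge_zero[of "norm a - norm b" "norm c - norm d"]
      sum_squares_ge_zero[of "norm a - norm c" "norm b - norm d"]
      sum_squares_ge_zero[of "norm a - norm d" "norm b - norm c"]
    by (simp add: power2_eq_square algebra_simps)
  finally show ?thesis .
qed

locale disc_weighted_composition =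
  fixes \<phi> \<psi> :: "complex \<Rightarrow> complex"
  assumes self_map: "holomorphic_self_map \<phi>" and weight_holomorphic: "\<psi> holomorphic_on unit_disc"
begin

lemma symbol_holomorphic: "\<phi> holomorphic_on unit_disc"
  and symbol_image: "\<phi> ` unit_disc \<subseteq> unit_disc"
  using self_map by (auto simp: holomorphic_self_map_def)

lemma symbol_in_disc: "z \<in> unit_disc \<Longrightarrow> \<phi> z \<in> unit_disc"
  using symbol_image by blast

lemma DERIV_compose_symbol:
  assumes "h holomorphic_on unit_disc" "z \<in> unit_disc"
  shows "((\<lambda>z. h (\<phi> z)) has_field_derivative deriv h (\<phi> z) * deriv \<phi> z) (at z)"
  by (rule DERIV_chain2[OF holomorphic_derivI[OF assms(1) open_ball symbol_in_disc[OF assms(2)]]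
        holomorphic_derivI[OF symbol_holomorphic open_ball assms(2)]])

lemma weighted_composition_holomorphic:
  assumes "f holomorphic_on unit_disc"
  shows "weighted_composition \<psi> \<phi> f holomorphic_on unit_disc"
  using holomorphic_on_mult[OF weight_holomorphic
      holomorphic_on_compose_gen[OF symbol_holomorphic assms symbol_image]]
  by (simp add: weighted_composition_def o_def)

lemma deriv_weighted_composition:
  assumes f: "f holomorphic_on unit_disc" and z: "z \<in> unit_disc"
  shows "deriv (weighted_composition \<psi> \<phi> f) z
           = deriv \<psi> z * f (\<phi> z) + \<psi> z * deriv f (\<phi> z) * deriv \<phi> z"
proof (rule DERIV_imp_deriv)
  show "(weighted_composition \<psi> \<phi> f has_field_derivative
      deriv \<psi> z * f (\<phi> z) + \<psi> z * deriv f (\<phi> z) * deriv \<phi> z) (at z)"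
    unfolding weighted_composition_def
    using DERIV_mult[OF holomorphic_derivI[OF weight_holomorphic open_ball z]
        DERIV_compose_symbol[OF f z]]
    by (simp add: algebra_simps)
qed

lemma deriv2_weighted_composition:
  assumes f: "f holomorphic_on unit_disc" and z: "z \<in> unit_disc"
  shows "deriv (deriv (weighted_composition \<psi> \<phi> f)) z =
     deriv (deriv \<psi>) z * f (\<phi> z) + 2 * (deriv \<phi> z * deriv \<psi> z) * deriv f (\<phi> z)
       + deriv (deriv \<phi>) z * \<psi> z * deriv f (\<phi> z)
       + deriv \<phi> z * \<psi> z * (deriv \<phi> z * deriv (deriv f) (\<phi> z))" (is "_ = ?D")
proof (rule DERIV_imp_deriv)
  note H = holomorphic_derivI[OF _ open_ball z]
  have f': "deriv f holomorphic_on unit_disc"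
    using f by (intro holomorphic_deriv) auto
  have symbol': "deriv \<phi> holomorphic_on unit_disc" and weight': "deriv \<psi> holomorphic_on unit_disc"
    using symbol_holomorphic weight_holomorphic by (auto intro!: holomorphic_deriv)
  have "((\<lambda>z. deriv \<psi> z * f (\<phi> z) + \<psi> z * deriv f (\<phi> z) * deriv \<phi> z) has_field_derivative ?D) (at z)"
    using DERIV_add[OF DERIV_mult[OF H[OF weight'] DERIV_compose_symbol[OF f z]]
      DERIV_mult[OF DERIV_mult[OF H[OF weight_holomorphic] DERIV_compose_symbol[OF f' z]] H[OF
          symbol']]]
    by (simp add: algebra_simps)
  then show "(deriv (weighted_composition \<psi> \<phi> f) has_field_derivative ?D) (at z)"
    by (rule has_field_derivative_transform_within_open[OF _ open_ball z])
       (simp add: deriv_weighted_composition[OF f])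
qed

end

lemma one_minus_norm_square_pos: "z \<in> unit_disc \<Longrightarrow> 1 - (cmod z)\<^sup>2 > 0"
  using power_strict_mono[of "cmod z" 1 2] by simp

text \<open>
  This absorbs a coefficient of size \<open>M / w\<close>, where \<open>w = 1 - |z|\<^sup>2\<close>, and lowers the exponent of the weight
  by 2.
\<close>

lemma growth_bound_square:
  assumes "x * w \<le> M" "x \<ge> 0" "w > (0::real)"
  shows "(x * y)\<^sup>2 * w powr (\<alpha> + 2) \<le> M\<^sup>2 * (y\<^sup>2 * w powr \<alpha>)"
proof -
  have "(x * w)\<^sup>2 \<le> M\<^sup>2" using assms by (intro power_mono) auto
  then have "(x * w)\<^sup>2 * (y\<^sup>2 * w powr \<alpha>) \<le> M\<^sup>2 * (y\<^sup>2 * w powr \<alpha>)"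
    by (rule mult_right_mono) auto
  moreover have "w powr (\<alpha> + 2) = w powr \<alpha> * w\<^sup>2"
    using assms by (simp add: powr_add)
  ultimately show ?thesis by (simp add: power_mult_distrib mult_ac)
qed

text \<open>
  This moves the weight from \<open>w = 1 - |z|\<^sup>2\<close> to \<open>v = 1 - |\<phi> z|\<^sup>2\<close>: the exponent \<open>\<alpha> / 2 + 1\<close> in the hypothesis
  is half of the exponent in \<open>I (\<alpha> + 2)\<close>.
\<close>

lemma quotient_bound_square:
  assumes "x * (w / v) powr (\<alpha> / 2 + 1) \<le> M" "x \<ge> 0" "w > (0::real)" "v > 0"
  shows "(x * y)\<^sup>2 * w powr (\<alpha> + 2) \<le> M\<^sup>2 * (y\<^sup>2 * v powr (\<alpha> + 2))"
proof -
  have "(x * (w / v) powr (\<alpha> / 2 + 1))\<^sup>2 \<le> M\<^sup>2" using assms by (intro power_mono) auto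
  moreover have "((w / v) powr (\<alpha> / 2 + 1))\<^sup>2 = w powr (\<alpha> + 2) / v powr (\<alpha> + 2)"
  proof -
    have "((w / v) powr (\<alpha> / 2 + 1))\<^sup>2 = (w / v) powr (\<alpha> / 2 + 1 + (\<alpha> / 2 + 1))"
      by (simp only: powr_add power2_eq_square)
    also have "\<alpha> / 2 + 1 + (\<alpha> / 2 + 1) = \<alpha> + 2" by simp
    finally show ?thesis using assms by (simp only: powr_divide)
  qed
  ultimately have "x\<^sup>2 * w powr (\<alpha> + 2) / v powr (\<alpha> + 2) \<le> M\<^sup>2"
    by (simp only: power_mult_distrib times_divide_eq_right)
  then have "x\<^sup>2 * w powr (\<alpha> + 2) \<le> M\<^sup>2 * v powr (\<alpha> + 2)"
    using assms by (subst (asm) pos_divide_le_eq) auto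
  from mult_right_mono[OF this zero_le_power2[of y]] show ?thesis
    by (simp add: power_mult_distrib mult_ac)
qed

text \<open>
  The central estimate. In the proof \<open>J f\<close> bounds the integral of the second derivative of the image of
  \<open>f\<close>, while \<open>P0 f\<close> and \<open>P1 f\<close> bound the values at 0 of the image and of its derivative.
\<close>

lemma energy_dominated_weighted_composition:
  assumes \<alpha>: "\<alpha> > -1" and \<phi>: "holomorphic_self_map \<phi>" "inj_on \<phi> unit_disc"
    and \<psi>: "\<psi> holomorphic_on unit_disc"
    and b1: "bdd_above ((\<lambda>z. cmod (deriv (deriv \<psi>) z) * (1 - (cmod z)\<^sup>2)) ` unit_disc)"
    and b2: "bdd_above ((\<lambda>z. cmod (deriv \<phi> z * deriv \<psi> z) * (1 - (cmod z)\<^sup>2)) ` unit_disc)"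
    and b3: "bdd_above ((\<lambda>z. cmod (deriv (deriv \<phi>) z * \<psi> z) * (1 - (cmod z)\<^sup>2)) ` unit_disc)"
    and b4: "bdd_above ((\<lambda>z. cmod (deriv \<phi> z * \<psi> z) *
           ((1 - (cmod z)\<^sup>2) / (1 - (cmod (\<phi> z))\<^sup>2)) powr (\<alpha> / 2 + 1)) ` unit_disc)"
  shows "energy_dominated \<alpha> (\<lambda>f. dirichlet_energy \<alpha> (weighted_composition \<psi> \<phi> f))"
proof -
  obtain M1 where M1: "\<And>z. z \<in> unit_disc \<Longrightarrow> cmod (deriv (deriv \<psi>) z) * (1 - (cmod z)\<^sup>2) \<le> M1"
    using b1 unfolding bdd_above_def by blast
  obtain M2 where M2: "\<And>z. z \<in> unit_disc \<Longrightarrow> cmod (deriv \<phi> z * deriv \<psi> z) * (1 - (cmod z)\<^sup>2) \<le> M2"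
    using b2 unfolding bdd_above_def by blast
  obtain M3 where M3: "\<And>z. z \<in> unit_disc \<Longrightarrow> cmod (deriv (deriv \<phi>) z * \<psi> z) * (1 - (cmod z)\<^sup>2) \<le> M3"
    using b3 unfolding bdd_above_def by blast
  obtain M4 where M4: "\<And>z. z \<in> unit_disc \<Longrightarrow> cmod (deriv \<phi> z * \<psi> z) *
           ((1 - (cmod z)\<^sup>2) / (1 - (cmod (\<phi> z))\<^sup>2)) powr (\<alpha> / 2 + 1) \<le> M4"
    using b4 unfolding bdd_above_def by blast
  interpret disc_weighted_composition \<phi> \<psi>
    using \<phi> \<psi> by unfold_locales
  have \<phi>0: "\<phi> 0 \<in> unit_disc" by (rule symbol_in_disc) simp
  define T where "T = weighted_composition \<psi> \<phi>"
  define E where "E \<alpha> = ennreal (2 powr \<bar>1 - \<alpha>\<bar>)" for \<alpha> :: real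
  have \<alpha>2: "\<alpha> + 2 > -1" using \<alpha> by simp
  obtain D where D: "\<And>h. h holomorphic_on unit_disc \<Longrightarrow> dirichlet_energy (\<alpha> + 2 + 2) h
      \<le> ennreal D * bergman_integral (\<alpha> + 2) h"
    using bergman_integral_equiv_energy[OF \<alpha>2] by blast
  define J where "J f = ennreal (4 * M1\<^sup>2) * bergman_integral \<alpha> (f \<circ> \<phi>)
     + ennreal (4 * (4 * M2\<^sup>2 + M3\<^sup>2)) * bergman_integral \<alpha> (deriv f \<circ> \<phi>)
     + ennreal (4 * M4\<^sup>2) * bergman_integral (\<alpha> + 2) (deriv (deriv f))" for f
  define P0 where "P0 f = ennreal ((cmod (\<psi> 0))\<^sup>2) * ennreal ((cmod (f (\<phi> 0)))\<^sup>2)" for f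
  define P1 where "P1 f = ennreal (4 * (cmod (deriv \<psi> 0))\<^sup>2) * ennreal ((cmod (f (\<phi> 0)))\<^sup>2)
     + ennreal (4 * (cmod (\<psi> 0 * deriv \<phi> 0))\<^sup>2) * ennreal ((cmod (deriv f (\<phi> 0)))\<^sup>2)" for f
  have dom: "energy_dominated \<alpha> (\<lambda>f. P0 f + E \<alpha> * (P1 f + E (\<alpha> + 2) * (ennreal D * J f)))"
  proof -
    have comp: "energy_dominated (\<alpha> + 2) (\<lambda>f. bergman_integral \<alpha> (f \<circ> \<phi>))"
      by (rule energy_dominated_bergman_compose[OF \<phi> \<alpha>])
    have 1: "energy_dominated \<alpha> (\<lambda>f. bergman_integral \<alpha> (f \<circ> \<phi>))"
      by (rule energy_dominated_weaken[OF comp]) simp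
    have 2: "energy_dominated \<alpha> (\<lambda>f. bergman_integral \<alpha> (deriv f \<circ> \<phi>))"
      by (rule energy_dominated_deriv[OF comp])
    have 3: "energy_dominated \<alpha> (\<lambda>f. bergman_integral (\<alpha> + 2) (deriv (deriv f)))"
      by (rule energy_dominated_deriv[OF energy_dominated_deriv[OF energy_dominated_bergman[OF \<alpha>2]]])
    have 4: "energy_dominated \<alpha> (\<lambda>f. ennreal ((cmod (f (\<phi> 0)))\<^sup>2))"
      by (rule energy_dominated_point[OF \<phi>0])
    have 5: "energy_dominated \<alpha> (\<lambda>f. ennreal ((cmod (deriv f (\<phi> 0)))\<^sup>2))"
      by (rule energy_dominated_deriv[OF energy_dominated_point[OF \<phi>0]])
    show ?thesis
      unfolding P0_def P1_def J_def E_def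
      by (intro energy_dominated_add energy_dominated_cmult 1 2 3 4 5) simp_all
  qed
  have key: "bergman_integral (\<alpha> + 2) (deriv (deriv (T f)))
      \<le> J f" if f: "f holomorphic_on unit_disc" for f
  proof -
    have f': "deriv f holomorphic_on unit_disc" and f'': "deriv (deriv f) holomorphic_on unit_disc"
      and symbol': "deriv \<phi> holomorphic_on unit_disc"
      using f symbol_holomorphic by (auto intro!: holomorphic_deriv)
    have compose_measurable: "(\<lambda>z. h (\<phi> z)) \<in> borel_measurable (restrict_space borel unit_disc)"
      if "h holomorphic_on unit_disc" for h
      using holomorphic_borel_measurable_disc[OF holomorphic_on_compose_gen[OF symbol_holomorphic
          that symbol_image]]
      by (simp add: o_def)
    note [measurable] = compose_measurable[OF f] compose_measurable[OF f'] compose_measurable[OF f'']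
      holomorphic_borel_measurable_disc[OF symbol_holomorphic]
          holomorphic_borel_measurable_disc[OF symbol']
    define j1 where "j1 z = (cmod ((f \<circ> \<phi>) z))\<^sup>2 * (1 - (cmod z)\<^sup>2) powr \<alpha>" for z
    define j2 where "j2 z = (cmod ((deriv f \<circ> \<phi>) z))\<^sup>2 * (1 - (cmod z)\<^sup>2) powr \<alpha>" for z
    define j3 where "j3 z = (cmod (deriv \<phi> z))\<^sup>2 * ((cmod (deriv (deriv f) (\<phi> z)))\<^sup>2 * (1 - (cmod
        (\<phi> z))\<^sup>2) powr (\<alpha> + 2))" for z
    have j_nonneg: "j1 z \<ge> 0" "j2 z \<ge> 0" "j3 z \<ge> 0" for z
      by (simp_all add: j1_def j2_def j3_def)
    have [measurable]: "j1 \<in> borel_measurable (restrict_space borel unit_disc)"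
        "j2 \<in> borel_measurable (restrict_space borel unit_disc)"
        "j3 \<in> borel_measurable (restrict_space borel unit_disc)"
      unfolding j1_def[abs_def] j2_def[abs_def] j3_def[abs_def] o_def by measurable
    have pointwise: "(cmod (deriv (deriv (T f)) z))\<^sup>2 * (1 - (cmod z)\<^sup>2) powr (\<alpha> + 2)
        \<le> 4 * M1\<^sup>2 * j1 z + 4 * (4 * M2\<^sup>2 + M3\<^sup>2) * j2 z + 4 * M4\<^sup>2 * j3 z" if z: "z \<in> unit_disc" for z
    proof -
      have \<phi>z: "\<phi> z \<in> unit_disc" by (rule symbol_in_disc[OF z])
      define w where "w = 1 - (cmod z)\<^sup>2"
      define v where "v = 1 - (cmod (\<phi> z))\<^sup>2"
      have pos: "w > 0" "v > 0"
        using one_minus_norm_square_pos[OF z] one_minus_norm_square_pos[OF \<phi>z] by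
            (simp_all add: w_def v_def)
      define t1 where "t1 = deriv (deriv \<psi>) z * f (\<phi> z)"
      define t2 where "t2 = 2 * (deriv \<phi> z * deriv \<psi> z) * deriv f (\<phi> z)"
      define t3 where "t3 = deriv (deriv \<phi>) z * \<psi> z * deriv f (\<phi> z)"
      define t4 where "t4 = deriv \<phi> z * \<psi> z * (deriv \<phi> z * deriv (deriv f) (\<phi> z))"
      have b1: "(cmod t1)\<^sup>2 * w powr (\<alpha> + 2) \<le> M1\<^sup>2 * j1 z"
        using growth_bound_square[OF M1[OF z, folded w_def] norm_ge_zero pos(1), of "cmod (f (\<phi> z))"]
        by (simp add: t1_def j1_def w_def norm_mult)
      have b2: "(cmod t2)\<^sup>2 * w powr (\<alpha> + 2) \<le> 4 * M2\<^sup>2 * j2 z"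
      proof -
        have "(cmod (deriv \<phi> z * deriv \<psi> z) * cmod (deriv f (\<phi> z)))\<^sup>2 * w powr (\<alpha> + 2) \<le> M2\<^sup>2 * j2 z"
          using growth_bound_square[OF M2[OF z, folded w_def] norm_ge_zero pos(1), of
              "cmod (deriv f (\<phi> z))"]
          by (simp add: j2_def w_def)
        moreover have "(cmod t2)\<^sup>2 = 4 * (cmod (deriv \<phi> z * deriv \<psi> z) * cmod (deriv f (\<phi> z)))\<^sup>2"
          by (simp add: t2_def norm_mult power_mult_distrib)
        ultimately show ?thesis by simp
      qed
      have b3: "(cmod t3)\<^sup>2 * w powr (\<alpha> + 2) \<le> M3\<^sup>2 * j2 z"
        using growth_bound_square[OF M3[OF z, folded w_def] norm_ge_zero pos(1), of
            "cmod (deriv f (\<phi> z))"]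
        by (simp add: t3_def j2_def w_def norm_mult)
      have b4: "(cmod t4)\<^sup>2 * w powr (\<alpha> + 2) \<le> M4\<^sup>2 * j3 z"
        using quotient_bound_square[OF M4[OF z, folded w_def v_def] norm_ge_zero pos,
            of "cmod (deriv \<phi> z * deriv (deriv f) (\<phi> z))"]
        by (simp add: t4_def j3_def v_def norm_mult power_mult_distrib mult.assoc)
      have "(cmod (deriv (deriv (T f)) z))\<^sup>2 \<le> 4 * ((cmod t1)\<^sup>2 + (cmod t2)\<^sup>2 + (cmod t3)\<^sup>2
          + (cmod t4)\<^sup>2)"
        unfolding T_def deriv2_weighted_composition[OF f z] t1_def t2_def t3_def t4_def
        by (rule norm_add4_square_le)
      then have "(cmod (deriv (deriv (T f)) z))\<^sup>2 * w powr (\<alpha> + 2)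
          \<le> 4 * ((cmod t1)\<^sup>2 + (cmod t2)\<^sup>2 + (cmod t3)\<^sup>2 + (cmod t4)\<^sup>2) * w powr (\<alpha> + 2)"
        by (rule mult_right_mono) simp
      also have "\<dots> \<le> 4 * M1\<^sup>2 * j1 z + 4 * (4 * M2\<^sup>2 + M3\<^sup>2) * j2 z + 4 * M4\<^sup>2 * j3 z"
        using b1 b2 b3 b4 by (simp add: algebra_simps)
      finally show ?thesis by (simp add: w_def)
    qed
    have "bergman_integral (\<alpha> + 2) (deriv (deriv (T f))) \<le>
        (\<integral>\<^sup>+z. ennreal (4 * M1\<^sup>2) * ennreal (j1 z) + ennreal (4 * (4 * M2\<^sup>2 + M3\<^sup>2)) * ennreal (j2 z)
           + ennreal (4 * M4\<^sup>2) * ennreal (j3 z) \<partial>disc_area)"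
      unfolding bergman_integral_def
    proof (rule nn_integral_mono)
      fix z assume "z \<in> space disc_area"
      then have "z \<in> unit_disc" by (simp add: space_disc_area)
      from ennreal_leI[OF pointwise[OF this]]
      show "ennreal ((cmod (deriv (deriv (T f)) z))\<^sup>2 * (1 - (cmod z)\<^sup>2) powr (\<alpha> + 2))
          \<le> ennreal (4 * M1\<^sup>2) * ennreal (j1 z) + ennreal (4 * (4 * M2\<^sup>2 + M3\<^sup>2)) * ennreal (j2 z)
           + ennreal (4 * M4\<^sup>2) * ennreal (j3 z)"
        using j_nonneg by (simp add: ennreal_plus[symmetric] ennreal_mult[symmetric] del: ennreal_plus)
    qed
    also have "\<dots> = ennreal (4 * M1\<^sup>2) * (\<integral>\<^sup>+z. ennreal (j1 z) \<partial>disc_area)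
       + ennreal (4 * (4 * M2\<^sup>2 + M3\<^sup>2)) * (\<integral>\<^sup>+z. ennreal (j2 z) \<partial>disc_area)
       + ennreal (4 * M4\<^sup>2) * (\<integral>\<^sup>+z. ennreal (j3 z) \<partial>disc_area)"
    proof -
      have m: "(\<lambda>z. ennreal (j1 z)) \<in> borel_measurable disc_area"
          "(\<lambda>z. ennreal (j2 z)) \<in> borel_measurable disc_area"
          "(\<lambda>z. ennreal (j3 z)) \<in> borel_measurable disc_area"
        by measurable
      have m': "(\<lambda>z. c * ennreal (j1 z)) \<in> borel_measurable disc_area"
          "(\<lambda>z. c * ennreal (j2 z)) \<in> borel_measurable disc_area"
          "(\<lambda>z. c * ennreal (j3 z)) \<in> borel_measurable disc_area"
          "(\<lambda>z. c * ennreal (j1 z) + d * ennreal (j2 z)) \<in> borel_measurable disc_area" for c d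
        by measurable
      show ?thesis
        by (simp only: nn_integral_add nn_integral_cmult m m')
    qed
    \<comment> \<open>Univalence of \<open>\<phi>\<close> turns the integral of \<open>j3\<close> into one of \<open>f''\<close>.\<close>
    also have "\<dots> \<le> J f"
      unfolding J_def j1_def j2_def j3_def bergman_integral_def[of \<alpha>, symmetric]
      by (intro add_mono order_refl mult_left_mono univalent_substitution_le_bergman \<phi> f'') simp_all
    finally show ?thesis .
  qed
  from dom show ?thesis
  proof (rule energy_dominated_mono)
    fix f assume f: "f holomorphic_on unit_disc"
    have h: "T f holomorphic_on unit_disc"
      unfolding T_def by (rule weighted_composition_holomorphic[OF f])
    then have h2: "deriv (deriv (T f)) holomorphic_on unit_disc"
      by (intro holomorphic_deriv) auto
    have p0: "ennreal ((cmod (T f 0))\<^sup>2) = P0 f"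
      by (simp add: P0_def T_def weighted_composition_def norm_mult power_mult_distrib ennreal_mult')
    have p1: "ennreal ((cmod (deriv (T f) 0))\<^sup>2) \<le> P1 f"
    proof -
      have "(cmod (deriv (T f) 0))\<^sup>2 \<le> 4 * (cmod (deriv \<psi> 0))\<^sup>2 * (cmod (f (\<phi> 0)))\<^sup>2
          + 4 * (cmod (\<psi> 0 * deriv \<phi> 0))\<^sup>2 * (cmod (deriv f (\<phi> 0)))\<^sup>2"
        using norm_add4_square_le[of "deriv \<psi> 0 * f (\<phi> 0)" "\<psi> 0 * deriv f (\<phi> 0) * deriv \<phi> 0" 0 0]
          deriv_weighted_composition[OF f, of 0]
        by (simp add: T_def norm_mult power_mult_distrib mult_ac)
      from ennreal_leI[OF this] show ?thesis
        unfolding P1_def by (simp add: ennreal_plus[symmetric] ennreal_mult[symmetric] del: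
            ennreal_plus)
    qed
    have "dirichlet_energy \<alpha> (T f) \<le> ennreal ((cmod (T f 0))\<^sup>2) + E \<alpha> * dirichlet_energy (\<alpha>
        + 2) (deriv (T f))"
      unfolding E_def by (rule dirichlet_energy_le_deriv)
    also have "\<dots> \<le> P0 f + E \<alpha> * (ennreal ((cmod (deriv (T f) 0))\<^sup>2) + E (\<alpha>
        + 2) * dirichlet_energy (\<alpha> + 2 + 2) (deriv (deriv (T f))))"
      unfolding p0 E_def by (intro add_left_mono mult_left_mono dirichlet_energy_le_deriv) simp
    also have "\<dots> \<le> P0 f + E \<alpha> * (P1 f + E (\<alpha> + 2) * (ennreal D * J f))"
      using order.trans[OF D[OF h2] mult_left_mono[OF key[OF f]]]
      by (intro add_left_mono mult_left_mono add_mono p1) simp_all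
    finally show "dirichlet_energy \<alpha> (weighted_composition \<psi> \<phi> f)
        \<le> P0 f + E \<alpha> * (P1 f + E (\<alpha> + 2) * (ennreal D * J f))"
      by (simp add: T_def)
  qed
qed

lemma dirichlet_energy_eq_norm:
  assumes "f \<in> dirichlet_space \<alpha>"
  shows "dirichlet_energy \<alpha> f = ennreal ((dirichlet_norm \<alpha> f)\<^sup>2)"
proof -
  have sm: "summable (dirichlet_term \<alpha> f)" using assms by (simp add: dirichlet_space_def)
  have "dirichlet_energy \<alpha> f = ennreal (\<Sum>n. dirichlet_term \<alpha> f n)"
    unfolding dirichlet_energy_def
    by (rule suminf_ennreal2[OF dirichlet_term_nonneg sm])
  moreover have "(\<Sum>n. dirichlet_term \<alpha> f n) \<ge> 0"
    by (intro suminf_nonneg sm dirichlet_term_nonneg)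
  ultimately show ?thesis by (simp add: dirichlet_norm_def)
qed

lemma dirichlet_spaceI:
  assumes "f holomorphic_on unit_disc" "dirichlet_energy \<alpha> f < \<infinity>"
  shows "f \<in> dirichlet_space \<alpha>"
  using assms summable_suminf_not_top[of "dirichlet_term \<alpha> f"] dirichlet_term_nonneg
  by (auto simp: dirichlet_space_def dirichlet_energy_def)

theorem theorem1p1:
  fixes \<alpha> :: real and \<phi> \<psi> :: "complex \<Rightarrow> complex"
  assumes "\<alpha> \<in> {-1<..<1}"
    and "holomorphic_self_map \<phi>" and "inj_on \<phi> unit_disc"
    and "\<psi> holomorphic_on unit_disc"
    and "bdd_above ((\<lambda>z. cmod (deriv (deriv \<psi>) z) * (1 - (cmod z)\<^sup>2)) ` unit_disc)"
    and "bdd_above ((\<lambda>z. cmod (deriv \<phi> z * deriv \<psi> z) * (1 - (cmod z)\<^sup>2)) ` unit_disc)"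
    and "bdd_above ((\<lambda>z. cmod (deriv (deriv \<phi>) z * \<psi> z) * (1 - (cmod z)\<^sup>2)) ` unit_disc)"
    and "bdd_above ((\<lambda>z. cmod (deriv \<phi> z * \<psi> z) *
           ((1 - (cmod z)\<^sup>2) / (1 - (cmod (\<phi> z))\<^sup>2)) powr (\<alpha> / 2 + 1)) ` unit_disc)"
  shows "bounded_on_dirichlet_space \<alpha> (weighted_composition \<psi> \<phi>)"
proof -
  interpret disc_weighted_composition \<phi> \<psi>
    using assms by unfold_locales
  define T where "T = weighted_composition \<psi> \<phi>"
  have "energy_dominated \<alpha> (\<lambda>f. dirichlet_energy \<alpha> (T f))"
    unfolding T_def using assms by (intro energy_dominated_weighted_composition) auto
  then obtain C where C: "C < \<infinity>"
    "\<And>f. f holomorphic_on unit_disc \<Longrightarrow> dirichlet_energy \<alpha> (T f) \<le> C * dirichlet_energy \<alpha> f"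
    by (auto simp: energy_dominated_def)
  have maps: "T f \<in> dirichlet_space \<alpha>" if f: "f \<in> dirichlet_space \<alpha>" for f
  proof (rule dirichlet_spaceI)
    have fh: "f holomorphic_on unit_disc" using f by (simp add: dirichlet_space_def)
    have fin: "C * dirichlet_energy \<alpha> f < \<infinity>"
      using C(1) dirichlet_energy_eq_norm[OF f] by (simp add: ennreal_mult_less_top)
    show "T f holomorphic_on unit_disc"
      unfolding T_def by (rule weighted_composition_holomorphic[OF fh])
    show "dirichlet_energy \<alpha> (T f) < \<infinity>"
      by (rule le_less_trans[OF C(2)[OF fh] fin])
  qed
  have norm: "dirichlet_norm \<alpha> (T f) \<le> sqrt (enn2real C) * dirichlet_norm \<alpha> f" if f:
      "f \<in> dirichlet_space \<alpha>" for f
  proof -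
    have fh: "f holomorphic_on unit_disc" using f by (simp add: dirichlet_space_def)
    have "ennreal ((dirichlet_norm \<alpha> (T f))\<^sup>2) \<le> ennreal (enn2real C) * ennreal ((dirichlet_norm \<alpha>
        f)\<^sup>2)"
      using C(1) C(2)[OF fh] by (simp add: dirichlet_energy_eq_norm f maps)
    then have "(dirichlet_norm \<alpha> (T f))\<^sup>2 \<le> enn2real C * (dirichlet_norm \<alpha> f)\<^sup>2"
      by (simp add: ennreal_mult[symmetric] zero_le_mult_iff)
    also have "\<dots> = (sqrt (enn2real C) * dirichlet_norm \<alpha> f)\<^sup>2"
      by (simp add: power_mult_distrib)
    finally show ?thesis
      by (rule power2_le_imp_le)
         (use f in \<open>simp add: dirichlet_norm_def dirichlet_space_def suminf_nonneg
             dirichlet_term_nonneg\<close>)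
  qed
  show ?thesis
    unfolding bounded_on_dirichlet_space_def T_def[symmetric]
  proof (intro conjI ballI allI exI)
    show "T f \<in> dirichlet_space \<alpha>" if "f \<in> dirichlet_space \<alpha>" for f
      using that by (rule maps)
    show "dirichlet_norm \<alpha> (T f) \<le> sqrt (enn2real C) * dirichlet_norm \<alpha> f" if
        "f \<in> dirichlet_space \<alpha>" for f
      using that by (rule norm)
  qed (simp_all add: T_def weighted_composition_def algebra_simps)
qed

end
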